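(* Let $p=p(n)$, $d=p(n-1)$, and suppose that $\log^3 n\ll d=o(n)$. Let $i\ge1$ be the largest integer such that $d^i=o(n)$, and let $c=c(n)=d^{i+1}/n$. Suppose that $e^c>(\log n)/(3\log\log n)$ and $c\le 3\log n$. Let $G=(V,E)\in G(n,p)$. Then a.a.s. $$\beta(G)\ge\left(\frac{i}{i+1}+o(1)\right)\left(\frac{d^i}{n}+e^{-c}\right)^{-1}\log n.$$
   Context: For a finite connected graph $G=(V,E)$ and $R=\{r_1,\dots,r_k\}\subseteq V$, $d_R(v)$ is the vector of graph distances from $v$ to $r_1,\dots,r_k$; $R$ is resolving if $d_R(v)\ne d_R(w)$ for all distinct $v,w$; the metric dimension $\beta(G)$ is the minimum size of a resolving set. $G(n,p)$ is the binomial random graph on $\{1,\dots,n\}$ with each pair an edge independently with probability $p=p(n)$. Asymptotics are as $n\to\infty$; a.a.s. means with probability tending to $1$; $f\ll g$ means $f=o(g)$. $\log$ is the natural logarithm. *)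

theory Defs
  imports "HOL-Probability.Probability" "HOL-Probability.Product_PMF"
    "HOL-Library.Landau_Symbols" "HOL-Library.Extended_Nat"
begin

text \<open>A simple graph is given by a vertex set and a set of two-element edges.\<close>

definition vertex_pairs :: "'a set \<Rightarrow> 'a set set" where
  "vertex_pairs V = {e. e \<subseteq> V \<and> card e = 2}"

text \<open>The distance is the length of a shortest walk; it is \<open>\<infinity>\<close> (the infimum of the
  empty set) between different components. Thus the metric dimension below is also meaningful
  for disconnected graphs, and on connected graphs it is the usual one.\<close>

definition graph_dist :: "'a set set \<Rightarrow> 'a \<Rightarrow> 'a \<Rightarrow> enat" where
  "graph_dist E u v = (INF k \<in> {k. (u, v) \<in> {(x, y). {x, y} \<in> E} ^^ k}. enat k)"

definition dist_vector :: "'a set set \<Rightarrow> 'a set \<Rightarrow> 'a \<Rightarrow> 'a \<Rightarrow> enat" where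
  "dist_vector E R v = (\<lambda>r\<in>R. graph_dist E v r)"

definition resolving :: "'a set \<Rightarrow> 'a set set \<Rightarrow> 'a set \<Rightarrow> bool" where
  "resolving V E R \<longleftrightarrow> R \<subseteq> V \<and>
     (\<forall>v\<in>V. \<forall>w\<in>V. v \<noteq> w \<longrightarrow> dist_vector E R v \<noteq> dist_vector E R w)"

definition metric_dimension :: "'a set \<Rightarrow> 'a set set \<Rightarrow> nat" where
  "metric_dimension V E = Min (card ` {R. resolving V E R})"

definition random_graph :: "nat \<Rightarrow> real \<Rightarrow> nat set set pmf" where
  "random_graph n p =
     map_pmf (\<lambda>f. {e \<in> vertex_pairs {1..n}. f e})
       (Pi_pmf (vertex_pairs {1..n}) False (\<lambda>_. bernoulli_pmf p))"

text \<open>\<open>i\<close> is the largest integer with \<open>d^i = o(n)\<close>. As \<open>d\<close> may be as small as a power of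
  \<open>log n\<close>, the exponent has to be allowed to depend on \<open>n\<close>; ``largest'' then refers to
  eventual domination of all other admissible exponent sequences. A fixed exponent is the case
  of a constant sequence; it is largest in this sense if \<open>d^i = o(n)\<close> and
  \<open>d^(i+1)/n\<close> tends to infinity.\<close>

definition largest_exponent :: "(nat \<Rightarrow> real) \<Rightarrow> (nat \<Rightarrow> nat) \<Rightarrow> bool" where
  "largest_exponent d i \<longleftrightarrow>
     (\<lambda>n. d n ^ i n) \<in> o(\<lambda>n. real n) \<and>
     (\<forall>j :: nat \<Rightarrow> nat. (\<lambda>n. d n ^ j n) \<in> o(\<lambda>n. real n) \<longrightarrow>
        (\<forall>\<^sub>F n in sequentially. j n \<le> i n))"

end

theory Submission
  imports Defs "HOL-Real_Asymp.Real_Asymp"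
begin

text \<open>
  Fix a set \<open>R\<close> of \<open>s\<close> vertices and expose the graph in stages. Once the ball of radius \<open>i - 1\<close>
  around \<open>R\<close> is known, every other vertex independently has no neighbour in it, so that its distance to
  \<open>R\<close> exceeds \<open>i\<close>, with probability about \<open>exp (- s d^i / n)\<close>. Once the ball of radius \<open>i\<close>
  is known, each of these far vertices is independently adjacent to the \<open>i\<close>-balls of all elements of \<open>R\<close>,
  so that its distance is exactly \<open>i + 1\<close> to all of them, with probability about \<open>exp (- s exp (- c))\<close> (Harris'
  inequality). If \<open>s\<close> is below the claimed bound, about \<open>n^(1/(i+1) + \<epsilon>)\<close> such vertices are expected,
  and fewer than two occur with probability too small to matter even after summing over all \<open>n^s\<close> choices
  of \<open>R\<close>.

  The sizes of the balls are controlled by an expansion property which holds for all vertex sets simultaneously: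
  since the error \<open>sqrt (log n / d)\<close> per step is \<open>o(1 / log n)\<close>, a union bound over all sets is affordable.
  The exceptional elements of \<open>R\<close>, most of whose \<open>i\<close>-ball is already swallowed by the ball of radius
  \<open>i - 1\<close> around \<open>R\<close>, are only \<open>o(log n)\<close> many, because by the same expansion property distinct balls are
  almost disjoint. They are at distance \<open>i + 1\<close> or \<open>i + 2\<close>, so they are dealt with by the pigeonhole
  principle.
\<close>

section \<open>Product Bernoulli measures on the subsets of a finite set\<close>

text \<open>The expectation of \<open>f\<close> at a random subset of \<open>I\<close> that contains
  each element independently with probability \<open>p\<close>. As a finite sum it allows induction
  on \<open>I\<close> and conditioning without measurability questions; the link with
  \<open>random_graph\<close> is \<open>prob_random_graph\<close>.\<close>

definition bexp :: "real \<Rightarrow> 'a set \<Rightarrow> ('a set \<Rightarrow> real) \<Rightarrow> real" where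
  "bexp p I f = (\<Sum>S\<in>Pow I. p ^ card S * (1 - p) ^ card (I - S) * f S)"

lemma bexp_empty [simp]: "bexp p {} f = f {}"
  by (simp add: bexp_def)

lemma bexp_cong: "(\<And>S. S \<subseteq> I \<Longrightarrow> f S = g S) \<Longrightarrow> bexp p I f = bexp p I g"
  by (simp add: bexp_def)

lemma bexp_mono:
  assumes "0 \<le> p" "p \<le> 1" "\<And>S. S \<subseteq> I \<Longrightarrow> f S \<le> g S"
  shows "bexp p I f \<le> bexp p I g"
  unfolding bexp_def using assms by (intro sum_mono mult_left_mono) auto

lemma bexp_add: "bexp p I (\<lambda>S. f S + g S) = bexp p I f + bexp p I g"
  by (simp add: bexp_def distrib_left sum.distrib)

lemma bexp_cmult: "bexp p I (\<lambda>S. x * f S) = x * bexp p I f"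
  by (simp add: bexp_def sum_distrib_left mult_ac)

lemma bexp_sum: "bexp p I (\<lambda>S. \<Sum>x\<in>A. f x S) = (\<Sum>x\<in>A. bexp p I (f x))"
  unfolding bexp_def by (subst sum.swap) (simp add: sum_distrib_left)

text \<open>Conditioning on whether \<open>a\<close> is chosen. The inductions over \<open>I\<close>
  below rest on this recursion.\<close>

lemma bexp_insert:
  assumes "finite I" "a \<notin> I"
  shows "bexp p (insert a I) f = p * bexp p I (\<lambda>S. f (insert a S)) + (1 - p) * bexp p I f"
proof -
  have inj: "inj_on (insert a) (Pow I)"
    using assms(2) by (auto simp: inj_on_def)
  have disj: "Pow I \<inter> insert a ` Pow I = {}"
    using assms(2) by auto
  have 1: "(\<Sum>S\<in>insert a ` Pow I. p ^ card S * (1 - p) ^ card (insert a I - S) * f S)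
      = p * bexp p I (\<lambda>S. f (insert a S))"
    unfolding bexp_def sum.reindex[OF inj] sum_distrib_left o_def
  proof (intro sum.cong refl)
    fix S assume "S \<in> Pow I"
    then have "card (insert a S) = Suc (card S)" "insert a I - insert a S = I - S"
      using assms by (auto simp: card_insert_if finite_subset)
    then show "p ^ card (insert a S) * (1 - p) ^ card (insert a I - insert a S) * f (insert a S)
      = p * (p ^ card S * (1 - p) ^ card (I - S) * f (insert a S))"
      by simp
  qed
  have 2: "(\<Sum>S\<in>Pow I. p ^ card S * (1 - p) ^ card (insert a I - S) * f S) = (1 - p) * bexp p I f"
    unfolding bexp_def sum_distrib_left
  proof (intro sum.cong refl)
    fix S assume "S \<in> Pow I"
    then have "card (insert a I - S) = Suc (card (I - S))"
      using assms by (auto simp: insert_Diff_if)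
    then show "p ^ card S * (1 - p) ^ card (insert a I - S) * f S
      = (1 - p) * (p ^ card S * (1 - p) ^ card (I - S) * f S)"
      by simp
  qed
  show ?thesis
    using 1 2 assms disj
    by (simp add: bexp_def[of p "insert a I"] Pow_insert sum.union_disjoint)
qed

lemma bexp_const [simp]: "finite I \<Longrightarrow> bexp p I (\<lambda>S. x) = x"
  by (induction I rule: finite_induct) (simp_all add: bexp_insert algebra_simps)

section \<open>Independence over disjoint blocks, and correlation of increasing events\<close>

lemma bexp_union:
  assumes "finite I" "finite J" "I \<inter> J = {}"
  shows "bexp p (I \<union> J) f = bexp p I (\<lambda>S. bexp p J (\<lambda>T. f (S \<union> T)))"
  using assms(1,3)
proof (induction I arbitrary: f rule: finite_induct)
  case (insert a I)
  then show ?case using assms(2) by (simp add: bexp_insert)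
qed simp

lemma bexp_restrict:
  assumes "finite I" "J \<subseteq> I"
  shows "bexp p I (\<lambda>S. f (S \<inter> J)) = bexp p J f"
proof -
  have "bexp p I (\<lambda>S. f (S \<inter> J)) = bexp p (J \<union> (I - J)) (\<lambda>S. f (S \<inter> J))"
    using assms by (simp add: Un_absorb1)
  also have "\<dots> = bexp p J (\<lambda>S. bexp p (I - J) (\<lambda>T. f ((S \<union> T) \<inter> J)))"
    using assms by (intro bexp_union) (auto intro: finite_subset)
  also have "\<dots> = bexp p J (\<lambda>S. bexp p (I - J) (\<lambda>T. f S))"
    by (intro bexp_cong arg_cong[where f = f]) auto
  also have "\<dots> = bexp p J f"
    using assms by simp
  finally show ?thesis .
qed

lemma bexp_prod_blocks:
  assumes "finite N" "\<And>v. v \<in> N \<Longrightarrow> finite (B v)" "disjoint_family_on B N"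
  shows "bexp p (\<Union>v\<in>N. B v) (\<lambda>S. \<Prod>v\<in>N. g v (S \<inter> B v)) = (\<Prod>v\<in>N. bexp p (B v) (g v))"
  using assms
proof (induction N rule: finite_induct)
  case (insert u N)
  have disj: "B u \<inter> (\<Union>v\<in>N. B v) = {}"
    using insert.prems(2) insert.hyps(2) by (fastforce simp: disjoint_family_on_def)
  have "bexp p (\<Union>v\<in>insert u N. B v) (\<lambda>S. \<Prod>v\<in>insert u N. g v (S \<inter> B v))
    = bexp p (B u) (\<lambda>S. bexp p (\<Union>v\<in>N. B v) (\<lambda>T. \<Prod>v\<in>insert u N. g v ((S \<union> T) \<inter> B v)))"
    using insert.prems insert.hyps disj by (simp add: bexp_union)
  also have "\<dots> = bexp p (B u) (\<lambda>S. bexp p (\<Union>v\<in>N. B v) (\<lambda>T. g u S * (\<Prod>v\<in>N. g v (T \<inter> B v))))"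
  proof (intro bexp_cong)
    fix S T assume S: "S \<subseteq> B u" and T: "T \<subseteq> (\<Union>v\<in>N. B v)"
    have "(S \<union> T) \<inter> B u = S" using S T disj by blast
    moreover have "(S \<union> T) \<inter> B v = T \<inter> B v" if "v \<in> N" for v using S that disj by blast
    ultimately show "(\<Prod>v\<in>insert u N. g v ((S \<union> T) \<inter> B v)) = g u S * (\<Prod>v\<in>N. g v (T \<inter> B v))"
      using insert.hyps by (simp cong: prod.cong)
  qed
  also have "\<dots> = bexp p (B u) (\<lambda>S. (\<Prod>v\<in>N. bexp p (B v) (g v)) * g u S)"
    using insert by (simp add: bexp_cmult disjoint_family_on_def mult.commute)
  also have "\<dots> = (\<Prod>v\<in>insert u N. bexp p (B v) (g v))"
    using insert.hyps by (simp add: bexp_cmult)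
  finally show ?case .
qed simp

text \<open>Harris' inequality, by conditioning on one element at a time: the conditional
  expectations given that element are again increasing in it.\<close>

lemma bexp_harris:
  assumes "finite I" "0 \<le> p" "p \<le> 1" "mono f" "mono g"
  shows "bexp p I f * bexp p I g \<le> bexp p I (\<lambda>S. f S * g S)"
  using assms(1,4,5)
proof (induction I arbitrary: f g rule: finite_induct)
  case (insert a I)
  let ?F0 = "bexp p I f" and ?F1 = "bexp p I (\<lambda>S. f (insert a S))"
  let ?G0 = "bexp p I g" and ?G1 = "bexp p I (\<lambda>S. g (insert a S))"
  have m: "mono (\<lambda>S. f (insert a S))" "mono (\<lambda>S. g (insert a S))"
    by (auto intro!: monoI insert.prems[THEN monoD])
  have "?F0 \<le> ?F1" "?G0 \<le> ?G1"
    using assms(2,3) insert.prems by (auto intro!: bexp_mono dest: monoD[OF _ subset_insertI])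
  \<comment> \<open>This product is exactly the covariance of the two-valued conditional
    expectations, so the next inequality is mere rearrangement.\<close>
  then have "0 \<le> p * (1 - p) * ((?F1 - ?F0) * (?G1 - ?G0))"
    using assms(2,3) by (intro mult_nonneg_nonneg) auto
  then have "(p * ?F1 + (1 - p) * ?F0) * (p * ?G1 + (1 - p) * ?G0)
      \<le> p * (?F1 * ?G1) + (1 - p) * (?F0 * ?G0)"
    by (simp add: algebra_simps power2_eq_square)
  also have "\<dots> \<le> p * bexp p I (\<lambda>S. f (insert a S) * g (insert a S)) + (1 - p) * bexp p I (\<lambda>S. f S * g S)"
    using assms(2,3) insert.IH[OF m] insert.IH[OF insert.prems]
    by (intro add_mono mult_left_mono) auto
  finally show ?case
    using insert.hyps by (simp add: bexp_insert)
qed simp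

lemma bexp_avoid:
  assumes "finite I" "T \<subseteq> I"
  shows "bexp p I (\<lambda>S. of_bool (S \<inter> T = {})) = (1 - p) ^ card T"
proof -
  have "bexp p T (\<lambda>S. of_bool (S = {})) = (1 - p) ^ card T" if "finite T" for T :: "'a set"
    using that by (induction T rule: finite_induct) (simp_all add: bexp_insert)
  then show ?thesis
    using assms bexp_restrict[of I T p "\<lambda>S. of_bool (S = {})"] by (simp add: finite_subset)
qed

text \<open>The sets \<open>T r\<close> may overlap, so the events of hitting them are not
  independent. They are increasing, however, and Harris' inequality bounds the joint probability by
  the product. This will be applied to the star of unexposed pairs at a single vertex.\<close>

lemma bexp_hit_all:
  assumes "finite I" "0 \<le> p" "p \<le> 1" "finite R" "\<And>r. r \<in> R \<Longrightarrow> T r \<subseteq> I"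
  shows "(\<Prod>r\<in>R. 1 - (1 - p) ^ card (T r)) \<le> bexp p I (\<lambda>S. of_bool (\<forall>r\<in>R. S \<inter> T r \<noteq> {}))"
  using assms(4,5)
proof (induction R rule: finite_induct)
  case (insert r R)
  have one: "bexp p I (\<lambda>S. of_bool (S \<inter> T r \<noteq> {})) = 1 - (1 - p) ^ card (T r)"
  proof -
    have "bexp p I (\<lambda>S. of_bool (S \<inter> T r \<noteq> {}) + of_bool (S \<inter> T r = {})) = bexp p I (\<lambda>S. 1)"
      by (intro bexp_cong) auto
    then show ?thesis
      using assms(1) insert.prems by (simp add: bexp_add bexp_avoid)
  qed
  have "(\<Prod>r\<in>insert r R. 1 - (1 - p) ^ card (T r))
    \<le> bexp p I (\<lambda>S. of_bool (S \<inter> T r \<noteq> {})) * bexp p I (\<lambda>S. of_bool (\<forall>r\<in>R. S \<inter> T r \<noteq> {}))"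
    using insert assms(2,3) by (auto simp: one power_le_one intro!: mult_left_mono)
  also have "\<dots> \<le> bexp p I (\<lambda>S. of_bool (S \<inter> T r \<noteq> {}) * of_bool (\<forall>r\<in>R. S \<inter> T r \<noteq> {}))"
  proof (intro bexp_harris assms)
    show "mono (\<lambda>S. of_bool (S \<inter> T r \<noteq> {}) :: real)"
      by (intro monoI) (auto simp: of_bool_def)
    show "mono (\<lambda>S. of_bool (\<forall>r\<in>R. S \<inter> T r \<noteq> {}) :: real)"
      by (intro monoI) (fastforce simp: of_bool_def)
  qed
  also have "\<dots> = bexp p I (\<lambda>S. of_bool (\<forall>r\<in>insert r R. S \<inter> T r \<noteq> {}))"
    by (intro bexp_cong) auto
  finally show ?case .
qed (use assms in simp)

section \<open>Exponential moments and Chernoff bounds for counts of independent events\<close>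

lemma bexp_count_mgf:
  fixes \<theta> :: real
  assumes "finite I" "finite N" "\<And>v. v \<in> N \<Longrightarrow> B v \<subseteq> I" "disjoint_family_on B N"
  shows "bexp p I (\<lambda>S. exp (\<theta> * card {v \<in> N. g v (S \<inter> B v)}))
    = (\<Prod>v\<in>N. 1 + (exp \<theta> - 1) * bexp p (B v) (\<lambda>S. of_bool (g v S)))"
proof -
  let ?U = "\<Union>v\<in>N. B v"
  have finB: "finite (B v)" if "v \<in> N" for v
    using assms(1,3) that by (auto intro: finite_subset)
  have "bexp p I (\<lambda>S. exp (\<theta> * card {v \<in> N. g v (S \<inter> B v)}))
    = bexp p I (\<lambda>S. (\<Prod>v\<in>N. 1 + (exp \<theta> - 1) * of_bool (g v ((S \<inter> ?U) \<inter> B v))))"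
  proof (intro bexp_cong)
    fix S
    have "exp (\<theta> * card {v \<in> N. g v (S \<inter> B v)}) = (\<Prod>v\<in>{v \<in> N. g v (S \<inter> B v)}. exp \<theta>)"
      by (simp add: exp_of_nat2_mult)
    also have "\<dots> = (\<Prod>v\<in>N. if g v (S \<inter> B v) then exp \<theta> else 1)"
      using assms(2) by (rule prod.inter_filter)
    also have "\<dots> = (\<Prod>v\<in>N. 1 + (exp \<theta> - 1) * of_bool (g v ((S \<inter> ?U) \<inter> B v)))"
    proof (intro prod.cong refl)
      fix v assume "v \<in> N"
      then have "(S \<inter> ?U) \<inter> B v = S \<inter> B v" by auto
      then show "(if g v (S \<inter> B v) then exp \<theta> else 1) = 1 + (exp \<theta> - 1) * of_bool (g v ((S \<inter> ?U) \<inter> B v))"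
        by simp
    qed
    finally show "exp (\<theta> * card {v \<in> N. g v (S \<inter> B v)}) = \<dots>" .
  qed
  also have "\<dots> = bexp p ?U (\<lambda>S. (\<Prod>v\<in>N. 1 + (exp \<theta> - 1) * of_bool (g v (S \<inter> B v))))"
    using assms by (intro bexp_restrict[where f = "\<lambda>S. (\<Prod>v\<in>N. 1 + (exp \<theta> - 1) * of_bool (g v (S \<inter> B v)))"]) auto
  also have "\<dots> = (\<Prod>v\<in>N. bexp p (B v) (\<lambda>S. 1 + (exp \<theta> - 1) * of_bool (g v S)))"
    using assms finB by (intro bexp_prod_blocks[where g = "\<lambda>v S. 1 + (exp \<theta> - 1) * of_bool (g v S)"]) auto
  also have "\<dots> = (\<Prod>v\<in>N. 1 + (exp \<theta> - 1) * bexp p (B v) (\<lambda>S. of_bool (g v S)))"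
    using finB by (intro prod.cong) (simp_all add: bexp_add bexp_cmult)
  finally show ?thesis .
qed

lemma exp_minus_le_quadratic:
  fixes \<theta> :: real
  assumes "0 \<le> \<theta>" "\<theta> \<le> 1"
  shows "exp (-\<theta>) \<le> 1 - (\<theta> - \<theta>\<^sup>2 / 2)"
proof -
  \<comment> \<open>The product equals (1 + \<theta>^2/2)^2 - \<theta>^2 = 1 + \<theta>^4/4.\<close>
  have "1 \<le> (1 - (\<theta> - \<theta>\<^sup>2 / 2)) * (1 + \<theta> + \<theta>\<^sup>2 / 2)"
    using assms(1) by (simp add: field_simps power2_eq_square)
  also have "\<dots> \<le> (1 - (\<theta> - \<theta>\<^sup>2 / 2)) * exp \<theta>"
  proof (rule mult_left_mono)
    show "1 + \<theta> + \<theta>\<^sup>2 / 2 \<le> exp \<theta>"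
      by (rule exp_lower_Taylor_quadratic[OF assms(1)])
    show "0 \<le> 1 - (\<theta> - \<theta>\<^sup>2 / 2)"
      using assms zero_le_power2[of \<theta>] by linarith
  qed
  finally show ?thesis by (simp add: exp_minus field_simps)
qed

text \<open>Markov's inequality for exp(-\<theta> X), where X counts events that live on the
  disjoint blocks \<open>B v\<close>. The parameter \<theta> stays free: the expansion property
  needs the small value \<open>lam\<close>, while the two exposure stages take \<theta> = 1.\<close>

lemma bexp_count_lower_tail:
  fixes \<theta> q :: real
  assumes "finite I" "finite N" "\<And>v. v \<in> N \<Longrightarrow> B v \<subseteq> I" "disjoint_family_on B N"
    and p: "0 \<le> p" "p \<le> 1" and \<theta>: "0 \<le> \<theta>" "\<theta> \<le> 1" and q: "0 \<le> q"
    and ge: "\<And>v. v \<in> N \<Longrightarrow> q \<le> bexp p (B v) (\<lambda>S. of_bool (g v S))"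
  shows "bexp p I (\<lambda>S. of_bool (real (card {v \<in> N. g v (S \<inter> B v)}) \<le> y))
    \<le> exp (\<theta> * y - card N * q * (\<theta> - \<theta>\<^sup>2 / 2))"
proof -
  let ?X = "\<lambda>S. real (card {v \<in> N. g v (S \<inter> B v)})"
  have finB: "finite (B v)" if "v \<in> N" for v
    using assms(1,3) that by (auto intro: finite_subset)
  have "bexp p I (\<lambda>S. of_bool (?X S \<le> y)) \<le> bexp p I (\<lambda>S. exp (\<theta> * y) * exp (-\<theta> * ?X S))"
  proof (intro bexp_mono p)
    fix S
    have "1 \<le> exp (\<theta> * y) * exp (-\<theta> * ?X S)" if "?X S \<le> y"
      using mult_left_mono[OF that \<theta>(1)] by (simp flip: exp_add)
    then show "of_bool (?X S \<le> y) \<le> exp (\<theta> * y) * exp (-\<theta> * ?X S)"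
      by (cases "?X S \<le> y") simp_all
  qed
  also have "\<dots> = exp (\<theta> * y) * (\<Prod>v\<in>N. 1 + (exp (-\<theta>) - 1) * bexp p (B v) (\<lambda>S. of_bool (g v S)))"
    using bexp_count_mgf[OF assms(1-4), of p "-\<theta>" g] by (simp add: bexp_cmult)
  also have "\<dots> \<le> exp (\<theta> * y) * (\<Prod>v\<in>N. exp (- q * (\<theta> - \<theta>\<^sup>2 / 2)))"
  proof (intro mult_left_mono prod_mono conjI)
    fix v assume v: "v \<in> N"
    let ?b = "bexp p (B v) (\<lambda>S. of_bool (g v S))"
    have b: "0 \<le> ?b" "?b \<le> 1"
      using ge[OF v] q bexp_mono[OF p, of "B v" "\<lambda>S. of_bool (g v S)" "\<lambda>S. 1"] finB[OF v] by auto
    have "(1 - exp (-\<theta>)) * ?b \<le> 1 * 1"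
      using b \<theta> by (intro mult_mono) auto
    then show "0 \<le> 1 + (exp (-\<theta>) - 1) * ?b"
      by (simp add: algebra_simps)
    have "(\<theta> - \<theta>\<^sup>2 / 2) * q \<le> (1 - exp (-\<theta>)) * ?b"
      using exp_minus_le_quadratic[OF \<theta>] ge[OF v] q \<theta> by (intro mult_mono) auto
    then have "1 + (exp (-\<theta>) - 1) * ?b \<le> 1 + (- q * (\<theta> - \<theta>\<^sup>2 / 2))"
      by (simp add: algebra_simps)
    also have "\<dots> \<le> exp (- q * (\<theta> - \<theta>\<^sup>2 / 2))"
      by (rule exp_ge_add_one_self)
    finally show "1 + (exp (-\<theta>) - 1) * ?b \<le> exp (- q * (\<theta> - \<theta>\<^sup>2 / 2))" .
  qed auto
  also have "\<dots> = exp (\<theta> * y - card N * q * (\<theta> - \<theta>\<^sup>2 / 2))"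
    by (simp add: algebra_simps flip: exp_of_nat_mult exp_add)
  finally show ?thesis .
qed

lemma bexp_count_upper_tail:
  fixes \<theta> q :: real
  assumes "finite I" "finite N" "\<And>v. v \<in> N \<Longrightarrow> B v \<subseteq> I" "disjoint_family_on B N"
    and p: "0 \<le> p" "p \<le> 1" and \<theta>: "0 \<le> \<theta>" "\<theta> \<le> 1"
    and le: "\<And>v. v \<in> N \<Longrightarrow> bexp p (B v) (\<lambda>S. of_bool (g v S)) \<le> q"
  shows "bexp p I (\<lambda>S. of_bool (y \<le> real (card {v \<in> N. g v (S \<inter> B v)})))
    \<le> exp (card N * q * (\<theta> + \<theta>\<^sup>2) - \<theta> * y)"
proof -
  let ?X = "\<lambda>S. real (card {v \<in> N. g v (S \<inter> B v)})"
  have "bexp p I (\<lambda>S. of_bool (y \<le> ?X S)) \<le> bexp p I (\<lambda>S. exp (- \<theta> * y) * exp (\<theta> * ?X S))"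
  proof (intro bexp_mono p)
    fix S
    have "1 \<le> exp (-\<theta> * y) * exp (\<theta> * ?X S)" if "y \<le> ?X S"
      using mult_left_mono[OF that \<theta>(1)] by (simp flip: exp_add)
    then show "of_bool (y \<le> ?X S) \<le> exp (-\<theta> * y) * exp (\<theta> * ?X S)"
      by (cases "y \<le> ?X S") simp_all
  qed
  also have "\<dots> = exp (-\<theta> * y) * (\<Prod>v\<in>N. 1 + (exp \<theta> - 1) * bexp p (B v) (\<lambda>S. of_bool (g v S)))"
    using bexp_count_mgf[OF assms(1-4), of p \<theta> g] by (simp add: bexp_cmult)
  also have "\<dots> \<le> exp (-\<theta> * y) * (\<Prod>v\<in>N. exp (q * (\<theta> + \<theta>\<^sup>2)))"
  proof (intro mult_left_mono prod_mono conjI)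
    fix v assume v: "v \<in> N"
    let ?b = "bexp p (B v) (\<lambda>S. of_bool (g v S))"
    have b: "0 \<le> ?b"
      unfolding bexp_def using p by (intro sum_nonneg) auto
    then show "0 \<le> 1 + (exp \<theta> - 1) * ?b"
      using \<theta> by simp
    have "(exp \<theta> - 1) * ?b \<le> (\<theta> + \<theta>\<^sup>2) * q"
      using exp_bound[OF \<theta>] le[OF v] b \<theta> by (intro mult_mono) auto
    then have "1 + (exp \<theta> - 1) * ?b \<le> 1 + q * (\<theta> + \<theta>\<^sup>2)"
      by (simp add: mult.commute)
    also have "\<dots> \<le> exp (q * (\<theta> + \<theta>\<^sup>2))"
      by (rule exp_ge_add_one_self)
    finally show "1 + (exp \<theta> - 1) * ?b \<le> exp (q * (\<theta> + \<theta>\<^sup>2))" .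
  qed auto
  also have "\<dots> = exp (card N * q * (\<theta> + \<theta>\<^sup>2) - \<theta> * y)"
    by (simp add: algebra_simps flip: exp_of_nat_mult exp_add)
  finally show ?thesis .
qed

text \<open>The set \<open>G E\<close> plays the part of the pairs not yet exposed: it is determined by \<open>E\<close> outside of it, so
  conditionally on \<open>E - G E\<close> its elements are still independent.\<close>

lemma bexp_resample:
  assumes fin: "finite I" and sub: "\<And>E. E \<subseteq> I \<Longrightarrow> G E \<subseteq> I"
    and stop: "\<And>E E'. E \<subseteq> I \<Longrightarrow> E' \<subseteq> I \<Longrightarrow> E' - G E = E - G E \<Longrightarrow> G E' = G E"
  shows "bexp p I f = bexp p I (\<lambda>E. bexp p (G E) (\<lambda>S. f ((E - G E) \<union> S)))"
proof -
  let ?w = "\<lambda>I S. p ^ card S * (1 - p) ^ card (I - S)"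
  \<comment> \<open>Resampling exchanges the part of \<open>E\<close> inside \<open>G E\<close> with
    the fresh sample \<open>S\<close>. Since \<open>G\<close> does not change under the exchange,
    \<open>?h\<close> is an involution, and it preserves the joint weight of the pair.\<close>
  let ?h = "\<lambda>(E, S). ((E - G E) \<union> S, E \<inter> G E)"
  let ?A = "Sigma (Pow I) (\<lambda>E. Pow (G E))"
  have G: "G ((E - G E) \<union> S) = G E" if "E \<subseteq> I" "S \<subseteq> G E" for E S
    using that sub[OF that(1)] by (intro stop) auto
  have split: "?w I E = ?w (I - G E) (E - G E) * ?w (G E) (E \<inter> G E)" if "E \<subseteq> I" for E
  proof -
    have "card E = card (E - G E) + card (E \<inter> G E)"
      using that fin by (subst card_Un_disjoint[symmetric]) (auto intro: finite_subset arg_cong[where f = card])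
    moreover have "card (I - E) = card ((I - G E) - (E - G E)) + card (G E - E \<inter> G E)"
      using that fin sub[OF that] by (subst card_Un_disjoint[symmetric]) (auto intro: finite_subset arg_cong[where f = card])
    ultimately show ?thesis by (simp add: power_add)
  qed
  have finG: "finite (G E)" if "E \<subseteq> I" for E
    using sub[OF that] fin by (rule finite_subset)
  have "bexp p I (\<lambda>E. bexp p (G E) (\<lambda>S. f ((E - G E) \<union> S)))
    = (\<Sum>(E, S)\<in>?A. ?w I E * (?w (G E) S * f ((E - G E) \<union> S)))"
    unfolding bexp_def sum_distrib_left using fin finG by (subst sum.Sigma) auto
  also have "\<dots> = (\<Sum>(E, S)\<in>?A. ?w I E * (?w (G E) S * f E))"
  proof (rule sum.reindex_bij_witness[of _ ?h ?h])
    fix x assume x: "x \<in> ?A"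
    then obtain E S where *: "x = (E, S)" "E \<subseteq> I" "S \<subseteq> G E"
      by blast
    let ?E = "E - G E \<union> S"
    have E: "?E \<subseteq> I" using * sub by blast
    have 1: "?E - G E = E - G E" "?E \<inter> G E = S" using * by auto
    have 2: "E - G E \<union> E \<inter> G E = E" by auto
    show "?h (?h x) = x"
      using * by (simp add: G 1 2)
    then show "?h (?h x) = x" .
    show "?h x \<in> ?A"
      using * E by (simp add: G)
    then show "?h x \<in> ?A" .
    have "?w I ?E * (?w (G E) (E \<inter> G E) * f ?E) = ?w I E * (?w (G E) S * f ?E)"
      using split[OF E] split[OF *(2)] by (simp add: G[OF *(2,3)] 1)
    then show "(case ?h x of (E, S) \<Rightarrow> ?w I E * (?w (G E) S * f E))
      = (case x of (E, S) \<Rightarrow> ?w I E * (?w (G E) S * f ((E - G E) \<union> S)))"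
      by (simp add: *(1) G[OF *(2,3)])
  qed
  also have "\<dots> = bexp p I (\<lambda>E. bexp p (G E) (\<lambda>S. f E))"
    unfolding bexp_def sum_distrib_left using fin finG by (subst sum.Sigma) auto
  also have "\<dots> = bexp p I f"
    using finG by (intro bexp_cong) simp
  finally show ?thesis ..
qed

section \<open>The random graph as a product Bernoulli measure\<close>

lemma expectation_Pi_pmf_bernoulli:
  assumes "finite I" "0 \<le> p" "p \<le> 1"
  shows "measure_pmf.expectation (Pi_pmf I False (\<lambda>_. bernoulli_pmf p)) (\<lambda>h. f {e \<in> I. h e}) = bexp p I f"
  using assms(1)
proof (induction I arbitrary: f rule: finite_induct)
  case (insert a I)
  have eq: "{e \<in> insert a I. (h(a := x)) e} = (if x then insert a {e \<in> I. h e} else {e \<in> I. h e})" for h x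
    using insert.hyps by auto
  have fin: "finite (set_pmf (Pi_pmf I False (\<lambda>_. bernoulli_pmf p)))"
    using insert.hyps by (auto intro!: finite_subset[OF set_Pi_pmf_subset'] finite_PiE_dflt)
  let ?D = "Pi_pmf I False (\<lambda>_. bernoulli_pmf p)"
  have "measure_pmf.expectation (Pi_pmf (insert a I) False (\<lambda>_. bernoulli_pmf p)) (\<lambda>h. f {e \<in> insert a I. h e})
    = measure_pmf.expectation (bernoulli_pmf p \<bind> (\<lambda>x. map_pmf (\<lambda>h. h(a := x)) ?D)) (\<lambda>h. f {e \<in> insert a I. h e})"
    using insert.hyps by (simp add: Pi_pmf_insert' map_pmf_def)
  also have "\<dots> = (\<Sum>x\<in>UNIV. pmf (bernoulli_pmf p) x *
      measure_pmf.expectation (map_pmf (\<lambda>h. h(a := x)) ?D) (\<lambda>h. f {e \<in> insert a I. h e}))"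
    using fin by (subst pmf_expectation_bind[of UNIV]) auto
  also have "\<dots> = p * bexp p I (\<lambda>S. f (insert a S)) + (1 - p) * bexp p I f"
    unfolding integral_map_pmf eq UNIV_bool using assms by (simp add: insert.IH insert.IH[of "\<lambda>S. f (insert a S)"])
  finally show ?case
    using insert.hyps by (simp add: bexp_insert)
qed simp

lemma prob_random_graph:
  assumes "0 \<le> p" "p \<le> 1"
  shows "measure_pmf.prob (random_graph n p) {E. P E} = bexp p (vertex_pairs {1..n}) (\<lambda>E. of_bool (P E))"
proof -
  have "finite (vertex_pairs {1..n})"
    by (rule finite_subset[of _ "Pow {1..n}"]) (auto simp: vertex_pairs_def)
  note * = expectation_Pi_pmf_bernoulli[OF this assms, of "\<lambda>E. of_bool (P E)"]
  have "(\<lambda>E. of_bool (P E)) = (indicator {E. P E} :: _ \<Rightarrow> real)"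
    by (auto simp: indicator_def)
  then have "measure_pmf.prob (random_graph n p) {E. P E}
      = measure_pmf.expectation (random_graph n p) (\<lambda>E. of_bool (P E))"
    by simp
  also have "\<dots> = bexp p (vertex_pairs {1..n}) (\<lambda>E. of_bool (P E))"
    unfolding random_graph_def integral_map_pmf by (rule *)
  finally show ?thesis .
qed

section \<open>Balls in graphs with good expansion\<close>

text \<open>The closed neighbourhood: keeping \<open>X\<close> makes the iterates balls rather than
  sets of endpoints of walks of one exact length.\<close>

definition nbhd :: "'a set set \<Rightarrow> 'a set \<Rightarrow> 'a set" where
  "nbhd E X = X \<union> {v. \<exists>x\<in>X. {x, v} \<in> E}"

definition gball :: "'a set set \<Rightarrow> nat \<Rightarrow> 'a set \<Rightarrow> 'a set" where
  "gball E k X = (nbhd E ^^ k) X"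

lemma gball_0 [simp]: "gball E 0 X = X"
  by (simp add: gball_def)

lemma gball_Suc [simp]: "gball E (Suc k) X = nbhd E (gball E k X)"
  by (simp add: gball_def)

lemma subset_nbhd: "X \<subseteq> nbhd E X"
  by (auto simp: nbhd_def)

lemma nbhd_mono: "X \<subseteq> Y \<Longrightarrow> nbhd E X \<subseteq> nbhd E Y"
  by (auto simp: nbhd_def)

lemma nbhd_UN: "nbhd E X = (\<Union>x\<in>X. nbhd E {x})"
  by (auto simp: nbhd_def)

lemma gball_mono: "X \<subseteq> Y \<Longrightarrow> gball E k X \<subseteq> gball E k Y"
  by (induction k) (simp_all add: nbhd_mono)

lemma gball_incr: "j \<le> k \<Longrightarrow> gball E j X \<subseteq> gball E k X"
  by (induction rule: dec_induct) (use subset_nbhd in fastforce)+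

lemma gball_UN: "gball E k X = (\<Union>x\<in>X. gball E k {x})"
proof (induction k)
  case (Suc k)
  have "gball E (Suc k) X = nbhd E (\<Union>x\<in>X. gball E k {x})"
    using Suc by simp
  also have "\<dots> = (\<Union>x\<in>X. nbhd E (gball E k {x}))"
    by (auto simp: nbhd_def)
  finally show ?case by simp
qed simp

text \<open>The ball of radius \<open>Suc k\<close> is found by inspecting only pairs that meet the
  ball of radius \<open>k\<close>. All other pairs may be resampled, which is what makes the staged
  exposure possible.\<close>

lemma gball_cong:
  assumes "\<And>x v. x \<in> gball E k X \<Longrightarrow> {x, v} \<in> E \<longleftrightarrow> {x, v} \<in> E'" and "j \<le> Suc k"
  shows "gball E' j X = gball E j X"
  using assms(2)
proof (induction j)
  case (Suc j)
  then have "gball E j X \<subseteq> gball E k X"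
    by (intro gball_incr) simp
  then have "{x, v} \<in> E \<longleftrightarrow> {x, v} \<in> E'" if "x \<in> gball E j X" for x v
    using that assms(1) by blast
  then show ?case
    using Suc by (auto simp: nbhd_def)
qed simp

lemma nbhd_subset: "E \<subseteq> vertex_pairs V \<Longrightarrow> X \<subseteq> V \<Longrightarrow> nbhd E X \<subseteq> V"
  by (fastforce simp: nbhd_def vertex_pairs_def)

lemma gball_subset: "E \<subseteq> vertex_pairs V \<Longrightarrow> X \<subseteq> V \<Longrightarrow> gball E k X \<subseteq> V"
  by (induction k) (simp_all add: nbhd_subset)

lemma ex_le_Suc: "(\<exists>j\<le>Suc k. P j) \<longleftrightarrow> (\<exists>j\<le>k. P j) \<or> (\<exists>j\<le>k. P (Suc j))"
proof
  assume "\<exists>j\<le>Suc k. P j"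
  then obtain j where "j \<le> k \<or> j = Suc k" "P j"
    by (auto simp: le_Suc_eq)
  then show "(\<exists>j\<le>k. P j) \<or> (\<exists>j\<le>k. P (Suc j))"
    by blast
next
  assume "(\<exists>j\<le>k. P j) \<or> (\<exists>j\<le>k. P (Suc j))"
  then show "\<exists>j\<le>Suc k. P j"
    by (meson Suc_le_mono le_SucI)
qed

lemma mem_gball_iff_relpow:
  "v \<in> gball E k {r} \<longleftrightarrow> (\<exists>j\<le>k. (v, r) \<in> {(x, y). {x, y} \<in> E} ^^ j)"
proof (induction k arbitrary: v)
  case (Suc k)
  let ?Q = "{(x, y). {x, y} \<in> E}"
  have "v \<in> gball E (Suc k) {r} \<longleftrightarrow> v \<in> gball E k {r} \<or> (\<exists>x. (v, x) \<in> ?Q \<and> x \<in> gball E k {r})"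
    by (auto simp: nbhd_def insert_commute)
  also have "\<dots> \<longleftrightarrow> (\<exists>j\<le>k. (v, r) \<in> ?Q ^^ j) \<or> (\<exists>j\<le>k. (v, r) \<in> ?Q ^^ Suc j)"
  proof -
    have "(v, r) \<in> ?Q ^^ Suc j \<longleftrightarrow> (\<exists>x. (v, x) \<in> ?Q \<and> (x, r) \<in> ?Q ^^ j)" for j
      by (meson relpow_Suc_D2 relpow_Suc_I2)
    then show ?thesis unfolding Suc by blast
  qed
  also have "\<dots> \<longleftrightarrow> (\<exists>j\<le>Suc k. (v, r) \<in> ?Q ^^ j)"
    by (rule ex_le_Suc[symmetric])
  finally show ?case .
qed simp

text \<open>Turns distances into ball membership, the form used everywhere below. A finite bound
  excludes the infimum over the empty set, and then the infimum is attained.\<close>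

lemma graph_dist_le_iff: "graph_dist E v r \<le> enat k \<longleftrightarrow> v \<in> gball E k {r}"
proof -
  let ?A = "{k. (v, r) \<in> {(x, y). {x, y} \<in> E} ^^ k}"
  have "graph_dist E v r \<le> enat k \<longleftrightarrow> (\<exists>j\<in>?A. enat j \<le> enat k)"
  proof
    assume *: "graph_dist E v r \<le> enat k"
    have "enat ` ?A \<noteq> {}"
    proof
      assume "enat ` ?A = {}"
      then show False using * by (simp add: graph_dist_def top_enat_def)
    qed
    then obtain x where "x \<in> enat ` ?A"
      by (meson ex_in_conv)
    then have "Inf (enat ` ?A) \<in> enat ` ?A"
      by (rule wellorder_InfI)
    then show "\<exists>j\<in>?A. enat j \<le> enat k"
      using * by (auto simp: graph_dist_def)
  next
    assume "\<exists>j\<in>?A. enat j \<le> enat k"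
    then show "graph_dist E v r \<le> enat k"
      unfolding graph_dist_def by (meson INF_lower2)
  qed
  then show ?thesis
    by (auto simp: mem_gball_iff_relpow)
qed

lemma graph_dist_eqI:
  assumes "v \<in> gball E (Suc k) {r}" "v \<notin> gball E k {r}"
  shows "graph_dist E v r = enat (Suc k)"
proof -
  have "graph_dist E v r \<le> enat (Suc k)" "\<not> graph_dist E v r \<le> enat k"
    using assms by (auto simp: graph_dist_le_iff simp del: gball_Suc)
  then show ?thesis
    by (cases "graph_dist E v r") auto
qed

section \<open>Sizes of balls under the expansion property\<close>

lemma card_nbhd_le:
  assumes "finite X" "\<And>x. x \<in> X \<Longrightarrow> real (card (nbhd E {x})) \<le> D"
  shows "real (card (nbhd E X)) \<le> D * card X"
proof -
  have "real (card (nbhd E X)) \<le> (\<Sum>x\<in>X. real (card (nbhd E {x})))"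
    unfolding nbhd_UN[of E X] using card_UN_le[OF assms(1), of "\<lambda>x. nbhd E {x}"]
    by (metis of_nat_le_iff of_nat_sum)
  also have "\<dots> \<le> (\<Sum>x\<in>X. D)"
    using assms(2) by (rule sum_mono)
  finally show ?thesis by (simp add: mult.commute)
qed

text \<open>The upper bound is needed for single vertices only, since it passes to sets by
  subadditivity; its summand 1 is the vertex itself. In the lower bound \<delta> covers random
  fluctuation, and the term 2 |X| d / |V| covers overlaps between neighbourhoods; the size condition
  keeps that term below 1/2.\<close>

definition typical :: "'a set \<Rightarrow> real \<Rightarrow> real \<Rightarrow> 'a set set \<Rightarrow> bool" where
  "typical V d \<delta> E \<longleftrightarrow>
     (\<forall>v\<in>V. real (card (nbhd E {v})) \<le> 1 + (1 + \<delta>) * d) \<and>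
     (\<forall>X\<subseteq>V. X \<noteq> {} \<longrightarrow> 4 * d * real (card X) \<le> real (card V) \<longrightarrow>
        real (card X) * d * (1 - \<delta> - 2 * real (card X) * d / real (card V)) \<le> real (card (nbhd E X)))"

text \<open>The error parameters. \<open>lam\<close> satisfies lam^2 d = 16 L, so that Chernoff's
  bound for one set \<open>X\<close> beats the number of sets of its size. \<open>K\<close> bounds
  the sets of vertices whose balls are shown to be almost disjoint; it leaves room for 4 L /
  \<kappa> + 1 vertices. \<open>mu\<close> is the relative error of one step of ball growth around
  such a set, and \<open>eta\<close> the accumulated error of \<open>i\<close> steps.\<close>

locale graph_params =
  fixes n i :: nat and p d c L \<kappa> lam K mu eta :: real
  assumes n: "n \<ge> 2" and i: "i \<ge> 1" and p: "0 \<le> p" "p \<le> 1 / 2"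
    and d_def: "d = p * (real n - 1)" and c_def: "c = d ^ (i + 1) / n" and L_def: "L = ln n"
    and lam_def: "lam = 4 * sqrt (L / d)" and K_def: "K = 5 * L / \<kappa>"
    and mu_def: "mu = lam + 6 * K * c / d" and eta_def: "eta = 2 * i * mu"
    and \<kappa>: "0 < \<kappa>" "\<kappa> \<le> 1 / 4"
    and d1: "d \<ge> 1" and c1: "c \<ge> 1" and L1: "L \<ge> 1" and dn: "4 * d \<le> n"
    and lam: "lam \<le> 1 / 10" and Kc: "8 * K * c \<le> d" and eta: "eta \<le> 1 / 16"
begin

lemma K1: "K \<ge> 1"
  using \<kappa> L1 by (simp add: K_def field_simps)

lemma lam0: "lam \<ge> 0"
  using L1 d1 by (simp add: lam_def)

lemma mu0: "mu \<ge> 0"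
  using lam0 K1 c1 d1 by (simp add: mu_def)

lemma imu: "i * mu \<le> 1 / 32" "eta \<ge> 0"
  using eta mu0 by (auto simp: eta_def)

lemma d_pow_i: "d ^ i = c * n / d"
  using n d1 by (simp add: c_def field_simps)

lemma finite_pairs: "finite (vertex_pairs {1..n})"
  by (rule finite_subset[of _ "Pow {1..n}"]) (auto simp: vertex_pairs_def)

end

locale typical_graph = graph_params +
  fixes E :: "nat set set"
  assumes E: "E \<subseteq> vertex_pairs {1..n}" and typE: "typical {1..n} d lam E"
begin

lemma gball_V: "X \<subseteq> {1..n} \<Longrightarrow> gball E k X \<subseteq> {1..n}"
  by (rule gball_subset[OF E])

lemma finite_gball: "X \<subseteq> {1..n} \<Longrightarrow> finite (gball E k X)"
  by (meson finite_subset gball_V finite_atLeastAtMost)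

lemma typical_expansion:
  assumes "X \<subseteq> {1..n}" "X \<noteq> {}" "4 * d * card X \<le> n"
  shows "card X * d * (1 - lam - 2 * card X * d / n) \<le> card (nbhd E X)"
  using typE assms by (auto simp: typical_def)

text \<open>Each step multiplies the size by at most d (1 + lam + 1/d), hence by at most d (1 + mu).
  Over at most \<open>i\<close> steps the error factor is at most exp(i mu), which is below 1 + eta
  because i mu is small.\<close>

lemma card_gball_le:
  assumes "X \<subseteq> {1..n}" "j \<le> i"
  shows "card (gball E j X) \<le> card X * d ^ j * (1 + eta)"
proof -
  let ?D = "1 + (1 + lam) * d"
  have D: "0 \<le> ?D" using lam0 d1 by simp
  have "card (gball E j X) \<le> card X * ?D ^ j"
  proof (induction j)
    case (Suc j)
    have "card (gball E (Suc j) X) \<le> ?D * card (gball E j X)"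
      using typE gball_V[OF assms(1)] finite_gball[OF assms(1)] unfolding gball_Suc typical_def
      by (intro card_nbhd_le) auto
    also have "\<dots> \<le> ?D * (card X * ?D ^ j)"
      using Suc D by (rule mult_left_mono)
    finally show ?case by (simp add: mult_ac)
  qed simp
  also have "\<dots> = card X * d ^ j * (1 + lam + 1 / d) ^ j"
    using d1 by (simp add: power_mult_distrib[symmetric] field_simps)
  also have "\<dots> \<le> card X * d ^ j * (1 + eta)"
  proof (intro mult_left_mono)
    \<comment> \<open>The summand 1/d, due to closed neighbourhoods containing their centres, is
      absorbed into \<open>mu\<close>.\<close>
    have "1 * 1 \<le> K * c" using K1 c1 by (intro mult_mono) auto
    then have "1 / d \<le> 6 * K * c / d"
      using d1 by (intro divide_right_mono) auto
    then have "1 + lam + 1 / d \<le> 1 + mu" by (simp add: mu_def)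
    also have "\<dots> \<le> exp mu" by (rule exp_ge_add_one_self)
    finally have "(1 + lam + 1 / d) ^ j \<le> exp mu ^ j"
      using lam0 d1 by (intro power_mono) auto
    also have "\<dots> = exp (j * mu)" by (simp add: exp_of_nat_mult)
    also have "\<dots> \<le> exp (i * mu)"
      using assms(2) mu0 by (simp add: mult_right_mono)
    also have "\<dots> \<le> 1 + i * mu + (i * mu)\<^sup>2"
      using imu mu0 by (intro exp_bound) auto
    also have "\<dots> \<le> 1 + eta"
    proof -
      have "(i * mu) * (i * mu) \<le> 1 * (i * mu)"
        using imu mu0 by (intro mult_right_mono) auto
      then show ?thesis by (simp add: eta_def power2_eq_square mult.commute)
    qed
    finally show "(1 + lam + 1 / d) ^ j \<le> 1 + eta" .
  qed (use d1 in auto)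
  finally show ?thesis .
qed

text \<open>The expansion property is applied to the balls of radius 0, ..., i - 1; each step loses
  a factor of at most 1 - mu, and Bernoulli's inequality collects the losses. Applied to several
  vertices at once, the bound says, together with \<open>card_gball_le\<close>, that their
  \<open>i\<close>-balls hardly overlap.\<close>

lemma card_gball_ge:
  assumes X: "X \<subseteq> {1..n}" "X \<noteq> {}" "card X \<le> K"
  shows "card X * d ^ i * (1 - eta) \<le> card (gball E i X)"
proof -
  have fin: "finite X" using X(1) by (rule finite_subset) simp
  have mu1: "mu \<le> 1"
  proof -
    have "1 * mu \<le> i * mu" using i mu0 by (intro mult_right_mono) auto
    then show ?thesis using imu by simp
  qed
  have "card X * d ^ j * (1 - mu) ^ j \<le> card (gball E j X)" if "j \<le> i" for j
    using that
  proof (induction j)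
    case (Suc j)
    let ?b = "real (card (gball E j X))"
    have "?b \<le> card X * d ^ j * (1 + eta)"
      using X(1) Suc.prems by (intro card_gball_le) auto
    also have "\<dots> \<le> K * d ^ j * 2"
      using X(3) d1 eta imu K1 by (intro mult_mono) auto
    finally have b: "?b * d \<le> 2 * K * d ^ Suc j"
      using d1 by (simp add: mult_ac mult_right_mono)
    also have "\<dots> \<le> 2 * K * d ^ i"
      using Suc.prems d1 K1 by (intro mult_left_mono power_increasing) auto
    also have "\<dots> = 2 * K * c / d * n"
      by (simp add: d_pow_i)
    finally have b: "?b * d \<le> 2 * K * c / d * n" .
    \<comment> \<open>This is the place where 8 K c \<le> d matters: even the ball of radius i - 1
      around \<open>K\<close> vertices is small enough for the expansion property.\<close>
    have "8 * K * c / d \<le> 1" using Kc d1 by simp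
    then have "4 * (2 * K * c / d * n) \<le> 1 * n"
      using mult_right_mono[of "8 * K * c / d" 1 "real n"] by (simp add: mult_ac)
    moreover have "4 * d * ?b = 4 * (?b * d)" by simp
    ultimately have size: "4 * d * ?b \<le> n"
      using b by linarith
    have ne: "gball E j X \<noteq> {}"
      using X(2) gball_incr[of 0 j E X] by auto
    have "2 * ?b * d / n \<le> 4 * K * c / d"
      using b n by (simp add: pos_divide_le_eq)
    also have "\<dots> \<le> 6 * K * c / d"
      using K1 c1 d1 by (intro divide_right_mono mult_right_mono) auto
    finally have "1 - mu \<le> 1 - lam - 2 * ?b * d / n"
      by (simp add: mu_def)
    then have "?b * d * (1 - mu) \<le> ?b * d * (1 - lam - 2 * ?b * d / n)"
      using d1 by (intro mult_left_mono) auto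
    also have "\<dots> \<le> card (gball E (Suc j) X)"
      using typical_expansion[of "gball E j X"] gball_V[OF X(1), of j] ne size by simp
    finally have "?b * (d * (1 - mu)) \<le> card (gball E (Suc j) X)" by (simp add: mult_ac)
    moreover have "card X * d ^ j * (1 - mu) ^ j * (d * (1 - mu)) \<le> ?b * (d * (1 - mu))"
      using Suc d1 mu1 by (intro mult_right_mono) auto
    ultimately show ?case by (simp add: mult_ac)
  qed simp
  from this[of i] have "card X * d ^ i * (1 - mu) ^ i \<le> card (gball E i X)" by simp
  moreover have "1 - eta \<le> (1 - mu) ^ i"
  proof -
    have "1 - eta \<le> 1 + i * (- mu)" using mu0 by (simp add: eta_def)
    also have "\<dots> \<le> (1 + (- mu)) ^ i" using mu1 by (intro Bernoulli_inequality) auto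
    finally show ?thesis by simp
  qed
  then have "card X * d ^ i * (1 - eta) \<le> card X * d ^ i * (1 - mu) ^ i"
    using d1 by (intro mult_left_mono) auto
  ultimately show ?thesis by linarith
qed

text \<open>The \<open>i\<close>-ball of one vertex may be too large for the expansion property, so
  it is replaced by a subset \<open>X\<close> of the largest admissible size k = floor(n / (4 d)).
  Then k d \<ge> n/8, and the expansion factor is at least 1 - 1/10 - 1/2 = 2/5, which gives
  n/20.\<close>

lemma card_nbhd_gball_ge:
  assumes "r \<in> {1..n}"
  shows "n / 20 \<le> card (nbhd E (gball E i {r}))"
proof -
  let ?B = "gball E i {r}"
  let ?k = "nat \<lfloor>n / (4 * d)\<rfloor>"
  have k: "?k \<le> n / (4 * d)" "n / (4 * d) < ?k + 1" "1 \<le> ?k"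
  proof -
    have "1 \<le> n / (4 * d)" using dn d1 by simp
    then show "?k \<le> n / (4 * d)" "n / (4 * d) < ?k + 1" "1 \<le> ?k" by linarith+
  qed
  have "n / (4 * d) \<le> d ^ i * (1 / 2)"
  proof -
    have "1 * real n \<le> 2 * c * real n" using c1 by (intro mult_right_mono) auto
    then show ?thesis using d1 by (simp add: d_pow_i field_simps)
  qed
  also have "\<dots> \<le> d ^ i * (1 - eta)"
    using eta d1 by (intro mult_left_mono) auto
  also have "\<dots> \<le> card ?B"
    using card_gball_ge[of "{r}"] assms K1 by simp
  finally have "real ?k \<le> card ?B" using k(1) by linarith
  then have "?k \<le> card ?B" by simp
  then obtain X where X: "X \<subseteq> ?B" "card X = ?k"
    by (meson obtain_subset_with_card_n)
  have XV: "X \<subseteq> {1..n}" using X(1) gball_V[of "{r}"] assms by auto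
  have kd: "4 * d * ?k \<le> n" "n \<le> 8 * d * ?k"
  proof -
    have "4 * d * ?k \<le> 4 * d * (n / (4 * d))"
      using k(1) d1 by (intro mult_left_mono) auto
    then show "4 * d * ?k \<le> n" using d1 by simp
    have "8 * d * (n / (4 * d)) \<le> 8 * d * (2 * ?k)"
      using k(2,3) d1 by (intro mult_left_mono) auto
    then show "n \<le> 8 * d * ?k" using d1 by simp
  qed
  have "n / 20 \<le> ?k * d * (1 - lam - 1 / 2)"
  proof -
    have "?k * d * (2 / 5) \<le> ?k * d * (1 - lam - 1 / 2)"
      using d1 lam by (intro mult_left_mono) auto
    then show ?thesis using kd by (simp add: mult_ac)
  qed
  also have "\<dots> \<le> ?k * d * (1 - lam - 2 * real ?k * d / n)"
  proof (intro mult_left_mono)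
    have "2 * real ?k * d \<le> 1 / 2 * n" using kd(1) by (simp add: mult_ac)
    then have "2 * real ?k * d / n \<le> 1 / 2" using n by (simp add: pos_divide_le_eq)
    then show "1 - lam - 1 / 2 \<le> 1 - lam - 2 * real ?k * d / n" by simp
  qed (use d1 in simp)
  also have "\<dots> \<le> card (nbhd E X)"
  proof -
    have "X \<noteq> {}" using X(2) k(3) by auto
    then show ?thesis
      using typical_expansion[of X] XV X(2) kd(1) by simp
  qed
  also have "\<dots> \<le> card (nbhd E ?B)"
    using X(1) finite_gball[of "{r}" "Suc i"] assms by (auto intro!: card_mono nbhd_mono)
  finally show ?thesis by simp
qed

text \<open>Let \<open>Q\<close> consist of k such vertices. Their joint \<open>i\<close>-ball has
  at least k d^i (1 - eta) elements, yet it is covered by \<open>W\<close> and k remainders of size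
  at most d^i (1 + eta - \<tau>). Comparing the two gives k (\<tau> - 2 eta) \<le> 2 L / c, and 4
  eta \<le> \<tau> turns this into the bound.\<close>

lemma card_heavy_le:
  assumes R: "R \<subseteq> {1..n}" and W: "finite W" "card W \<le> 2 * d ^ i * L / c"
    and \<tau>: "4 * eta \<le> \<tau>" "\<kappa> \<le> c * \<tau>"
  shows "card {r \<in> R. \<tau> * d ^ i \<le> card (gball E i {r} \<inter> W)} \<le> 4 * L / (c * \<tau>)" (is "real (card ?H) \<le> ?M")
proof (rule ccontr)
  assume "\<not> card ?H \<le> ?M"
  then have gt: "?M < card ?H" by simp
  have M0: "0 \<le> ?M" using L1 \<tau> \<kappa> by simp
  have \<tau>0: "\<tau> > 0"
  proof -
    have "0 < c * \<tau>" using \<kappa> \<tau>(2) by linarith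
    then show ?thesis using c1 by (simp add: zero_less_mult_iff)
  qed
  \<comment> \<open>The least integer above the claimed bound, rather than the number of all such
    vertices: the lower bound on balls holds only for at most \<open>K\<close> centres.\<close>
  define k where "k = nat \<lfloor>?M\<rfloor> + 1"
  have k: "?M < k" "k \<le> card ?H" "real k \<le> ?M + 1"
    using gt M0 unfolding k_def by linarith+
  have "?M \<le> 4 * L / \<kappa>"
    using \<tau>(2) \<kappa> L1 by (intro divide_left_mono) auto
  moreover have "1 \<le> L / \<kappa>"
    using \<kappa> L1 by simp
  ultimately have kK: "k \<le> K"
    using k(3) by (simp add: K_def)
  obtain Q where Q: "Q \<subseteq> ?H" "card Q = k"
    using k(2) by (meson obtain_subset_with_card_n)
  have QV: "Q \<subseteq> {1..n}" and finQ: "finite Q"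
    using Q(1) R by (auto intro: finite_subset[OF _ finite_atLeastAtMost])
  let ?B = "\<lambda>r. gball E i {r}"
  have finB: "finite (?B r)" "r \<in> {1..n}" if "r \<in> Q" for r
    using that QV finite_gball[of "{r}"] by auto
  have "k * d ^ i * (1 - eta) \<le> card (gball E i Q)"
  proof -
    have "Q \<noteq> {}" using Q(2) k_def by auto
    then show ?thesis
      using card_gball_ge[OF QV] Q(2) kK by simp
  qed
  also have "card (gball E i Q) \<le> card W + (\<Sum>r\<in>Q. card (?B r - W))"
  proof -
    have "card (gball E i Q) \<le> card (W \<union> (\<Union>r\<in>Q. ?B r - W))"
      using W(1) finQ finB by (intro card_mono) (auto simp: gball_UN[of E i Q])
    also have "\<dots> \<le> card W + card (\<Union>r\<in>Q. ?B r - W)"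
      by (rule card_Un_le)
    also have "card (\<Union>r\<in>Q. ?B r - W) \<le> (\<Sum>r\<in>Q. card (?B r - W))"
      using finQ by (rule card_UN_le)
    finally show ?thesis by simp
  qed
  finally have 1: "k * d ^ i * (1 - eta) \<le> card W + (\<Sum>r\<in>Q. real (card (?B r - W)))"
    by (simp flip: of_nat_sum of_nat_add)
  have "(\<Sum>r\<in>Q. real (card (?B r - W))) \<le> (\<Sum>r\<in>Q. d ^ i * (1 + eta) - \<tau> * d ^ i)"
  proof (rule sum_mono)
    fix r assume r: "r \<in> Q"
    have "card (?B r - W) + card (?B r \<inter> W) = card (?B r)"
      using finB[OF r] by (metis card_Diff_subset_Int card_mono finite_Int inf_le1 le_add_diff_inverse2)
    moreover have "card (?B r) \<le> d ^ i * (1 + eta)"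
      using card_gball_le[of "{r}" i] finB[OF r] by simp
    moreover have "\<tau> * d ^ i \<le> card (?B r \<inter> W)"
      using Q(1) r by auto
    ultimately show "real (card (?B r - W)) \<le> d ^ i * (1 + eta) - \<tau> * d ^ i" by linarith
  qed
  with 1 W(2) have "k * d ^ i * (1 - eta) \<le> 2 * d ^ i * L / c + k * (d ^ i * (1 + eta) - \<tau> * d ^ i)"
    by (simp add: Q(2))
  then have "d ^ i * (k * (\<tau> - 2 * eta)) \<le> d ^ i * (2 * L / c)"
    by (simp add: algebra_simps)
  then have "k * (\<tau> - 2 * eta) \<le> 2 * L / c"
    by (rule mult_left_le_imp_le) (use d1 in simp)
  moreover have "k * (\<tau> / 2) \<le> k * (\<tau> - 2 * eta)"
    using \<tau> by (intro mult_left_mono) auto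
  ultimately have "k * (\<tau> / 2) \<le> 2 * L / c" by linarith
  then have "k \<le> ?M"
    using c1 \<tau>0 by (simp add: pos_le_divide_eq mult_ac)
  with k(1) show False by simp
qed

end

section \<open>The random graph expands\<close>

lemma bexp_hit:
  assumes "finite T"
  shows "bexp p T (\<lambda>S. of_bool (S \<noteq> {})) = 1 - (1 - p) ^ card T"
proof -
  have "bexp p T (\<lambda>S. of_bool (S \<noteq> {}) + of_bool (S \<inter> T = {})) = bexp p T (\<lambda>S. 1)"
    by (intro bexp_cong) auto
  then show ?thesis
    using assms by (simp add: bexp_add bexp_avoid)
qed

context graph_params
begin

lemma p01: "0 \<le> p" "p \<le> 1"
  using p by auto

lemma lam_sq: "lam\<^sup>2 * d = 16 * L"
  using d1 L1 by (simp add: lam_def power_mult_distrib)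

text \<open>Chernoff's bound with \<theta> = lam/2. The number of neighbours has mean exactly
  \<open>d\<close>, and the exponent is -lam^2 d / 4 = -4 L.\<close>

lemma degree_tail:
  assumes "v \<in> {1..n}"
  shows "bexp p (vertex_pairs {1..n}) (\<lambda>E. of_bool (1 + (1 + lam) * d \<le> card (nbhd E {v}))) \<le> exp (- 4 * L)"
proof -
  let ?N = "{1..n} - {v}"
  let ?X = "\<lambda>E. card {u \<in> ?N. E \<inter> {{v, u}} \<noteq> {}}"
  have cardN: "real (card ?N) = real n - 1"
    using assms by (simp add: of_nat_diff)
  have "bexp p (vertex_pairs {1..n}) (\<lambda>E. of_bool (1 + (1 + lam) * d \<le> card (nbhd E {v})))
    = bexp p (vertex_pairs {1..n}) (\<lambda>E. of_bool ((1 + lam) * d \<le> ?X E))"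
  proof (intro bexp_cong)
    fix E :: "nat set set" assume E: "E \<subseteq> vertex_pairs {1..n}"
    have "nbhd E {v} = insert v {u \<in> ?N. E \<inter> {{v, u}} \<noteq> {}}"
      using E by (auto simp: nbhd_def vertex_pairs_def)
    then have "card (nbhd E {v}) = Suc (?X E)"
      by simp
    then show "of_bool (1 + (1 + lam) * d \<le> card (nbhd E {v})) = of_bool ((1 + lam) * d \<le> ?X E)"
      by simp
  qed
  also have "\<dots> \<le> exp (card ?N * p * (lam / 2 + (lam / 2)\<^sup>2) - lam / 2 * ((1 + lam) * d))"
  proof (rule bexp_count_upper_tail[where B = "\<lambda>u. {{v, u}}" and g = "\<lambda>u S. S \<noteq> {}"])
    show "{{v, u}} \<subseteq> vertex_pairs {1..n}" if "u \<in> ?N" for u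
      using that assms by (auto simp: vertex_pairs_def)
    show "disjoint_family_on (\<lambda>u. {{v, u}}) ?N"
      by (auto simp: disjoint_family_on_def doubleton_eq_iff)
    show "bexp p {{v, u}} (\<lambda>S. of_bool (S \<noteq> {})) \<le> p" for u
      by (simp add: bexp_hit)
  qed (use p01 lam lam0 finite_pairs in auto)
  also have "\<dots> = exp (- (lam\<^sup>2 * d) / 4)"
    unfolding cardN d_def by (simp add: field_simps power2_eq_square)
  also have "\<dots> = exp (- 4 * L)"
    by (simp add: lam_sq)
  finally show ?thesis .
qed

text \<open>Only neighbours outside \<open>X\<close> are counted; they are independent and their
  mean number is at least \<open>M\<close>. The threshold \<open>y\<close> is M - lam x d, and
  Chernoff's bound with \<theta> = lam gives an exponent of at most -lam^2 x d / 2 = -8 L x.\<close>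

lemma expansion_tail:
  assumes X: "X \<subseteq> {1..n}" "X \<noteq> {}" "4 * d * card X \<le> n"
  shows "bexp p (vertex_pairs {1..n})
      (\<lambda>E. of_bool (card (nbhd E X) \<le> card X * d * (1 - lam - 2 * real (card X) * d / n))) \<le> exp (- 8 * L * card X)"
proof -
  let ?N = "{1..n} - X" and ?B = "\<lambda>u. (\<lambda>y. {y, u}) ` X"
  let ?X = "\<lambda>E. card {u \<in> ?N. E \<inter> ?B u \<noteq> {}}"
  define x where "x = real (card X)"
  define y where "y = x * d * (1 - lam - 2 * x * d / n)"
  \<comment> \<open>A lower bound for the probability 1 - (1 - p)^x that a vertex outside
    \<open>X\<close> has a neighbour in \<open>X\<close>.\<close>
  define q where "q = p * x - (p * x)\<^sup>2 / 2"
  define M where "M = x * d * (1 - 2 * x * d / n)"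
  have fin: "finite X" using X(1) by (rule finite_subset) simp
  have x1: "x \<ge> 1"
    using X(2) fin by (simp add: x_def Suc_le_eq card_gt_0_iff)
  have px: "p * x \<le> 1 / 2"
  proof -
    have "p * x * (4 * (real n - 1)) \<le> n" using X(3) by (simp add: d_def x_def mult_ac)
    also have "\<dots> \<le> 1 / 2 * (4 * (real n - 1))" using n by simp
    finally show ?thesis using n by (simp add: mult_le_cancel_right)
  qed
  have q0: "0 \<le> q"
  proof -
    have "p * x * (p * x) \<le> p * x * 1" using px p x1 by (intro mult_left_mono) auto
    moreover have "0 \<le> p * x" using p x1 by simp
    ultimately show ?thesis by (simp add: q_def power2_eq_square)
  qed
  have cardB: "card (?B u) = card X" if "u \<in> ?N" for u
    using that by (intro card_image) (auto simp: inj_on_def doubleton_eq_iff)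
  have cardN: "real (card ?N) = n - x"
    using X(1) fin card_mono[OF _ X(1)] by (simp add: card_Diff_subset x_def of_nat_diff)
  have xn: "x \<le> n / 4"
  proof -
    have "1 * x \<le> d * x" using d1 x1 by (intro mult_right_mono) auto
    then show ?thesis using X(3) by (simp add: x_def)
  qed
  have "bexp p (vertex_pairs {1..n}) (\<lambda>E. of_bool (card (nbhd E X) \<le> y))
    \<le> bexp p (vertex_pairs {1..n}) (\<lambda>E. of_bool (?X E \<le> y))"
  proof (intro bexp_mono p01)
    fix E :: "nat set set" assume E: "E \<subseteq> vertex_pairs {1..n}"
    have "?X E \<le> card (nbhd E X)"
      using finite_subset[OF nbhd_subset[OF E X(1)]]
      by (intro card_mono) (auto simp: nbhd_def)
    then show "(of_bool (card (nbhd E X) \<le> y) :: real) \<le> of_bool (?X E \<le> y)"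
      by auto
  qed
  also have "\<dots> \<le> exp (lam * y - card ?N * q * (lam - lam\<^sup>2 / 2))"
  proof (rule bexp_count_lower_tail[where B = ?B and g = "\<lambda>u S. S \<noteq> {}"])
    show "?B u \<subseteq> vertex_pairs {1..n}" if "u \<in> ?N" for u
      using that X(1) by (auto simp: vertex_pairs_def card_2_iff)
    show "disjoint_family_on ?B ?N"
      by (auto simp: disjoint_family_on_def doubleton_eq_iff)
    show "q \<le> bexp p (?B u) (\<lambda>S. of_bool (S \<noteq> {}))" if "u \<in> ?N" for u
    proof -
      have "(1 - p) ^ card X \<le> exp (- p) ^ card X"
        using p01 exp_ge_add_one_self[of "- p"] by (intro power_mono) auto
      also have "\<dots> = exp (- (p * x))" by (simp add: x_def mult.commute flip: exp_of_nat_mult)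
      also have "\<dots> \<le> 1 - q"
        unfolding q_def using px p x1 by (intro exp_minus_le_quadratic) auto
      finally show ?thesis
        using fin by (simp add: bexp_hit cardB[OF that])
    qed
  qed (use p01 lam lam0 finite_pairs q0 in auto)
  also have "\<dots> \<le> exp (- 8 * L * x)"
  proof -
    have "M \<le> card ?N * q"
    proof -
      have pd: "d / n \<le> p" using p n by (simp add: d_def field_simps)
      have px2: "p * x / 2 \<le> x * d / n"
      proof -
        have "p * n \<le> 2 * d" using p n mult_left_mono[of 2 "real n" p] by (simp add: d_def algebra_simps)
        then have "p * n * x \<le> 2 * d * x" using x1 by (intro mult_right_mono) auto
        then show ?thesis using n by (simp add: field_simps)
      qed
      have xnd: "x / n \<le> x * d / n"
        using x1 d1 by (intro divide_right_mono) auto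
      \<comment> \<open>The two losses, x/n for the vertices of \<open>X\<close> that are not
        counted and p x / 2 for multiple edges into \<open>X\<close>, are each at most x d /
        n.\<close>
      have "1 - 2 * x * d / n \<le> (1 - x / n) * (1 - p * x / 2)"
      proof -
        have "1 - 2 * w \<le> (1 - a) * (1 - b)" if "0 \<le> a * b" "a \<le> w" "b \<le> w" for a b w :: real
          using that by (simp add: algebra_simps)
        from this[OF _ xnd px2] show ?thesis using p x1 by (simp add: mult.assoc)
      qed
      then have "M \<le> x * d * ((1 - x / n) * (1 - p * x / 2))"
        unfolding M_def using x1 d1 by (intro mult_left_mono) auto
      also have "\<dots> = d / n * ((n - x) * x * (1 - p * x / 2))"
        using n by (simp add: field_simps)
      also have "\<dots> \<le> p * ((n - x) * x * (1 - p * x / 2))"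
        using pd xn x1 px by (intro mult_right_mono) auto
      also have "\<dots> = card ?N * q"
        unfolding cardN q_def by (simp add: field_simps power2_eq_square)
      finally show ?thesis .
    qed
    moreover have "lam\<^sup>2 \<le> lam * (1/10)" using lam lam0 unfolding power2_eq_square by (rule mult_left_mono)
    ultimately have "M * (lam - lam\<^sup>2 / 2) \<le> card ?N * q * (lam - lam\<^sup>2 / 2)"
      using lam0 by (intro mult_right_mono) auto
    moreover have "lam * y - M * (lam - lam\<^sup>2 / 2) \<le> - 8 * L * x"
    proof -
      have "lam * y - M * (lam - lam\<^sup>2 / 2) = - (x * (lam\<^sup>2 * d) / 2) - x * d * (lam\<^sup>2 / 2) * (2 * x * d / n)"
        by (simp add: y_def M_def algebra_simps diff_divide_distrib power2_eq_square)
      moreover have "0 \<le> x * d * (lam\<^sup>2 / 2) * (2 * x * d / n)"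
        using x1 d1 by simp
      moreover have "x * (lam\<^sup>2 * d) / 2 = 8 * L * x"
        by (simp add: lam_sq)
      ultimately show ?thesis by linarith
    qed
    ultimately show ?thesis by simp
  qed
  finally show ?thesis by (simp add: x_def y_def)
qed

text \<open>A union bound over all vertices and all sets. The vertices cost n * n^(-4); a set
  \<open>X\<close> costs at most n^(-1) * n^(-|X|), and summing over all subsets gives (1 + 1/n)^n /
  n \<le> 3 / n.\<close>

lemma prob_not_typical:
  "bexp p (vertex_pairs {1..n}) (\<lambda>E. of_bool (\<not> typical {1..n} d lam E)) \<le> 4 / n"
proof -
  let ?V = "{1..n}"
  let ?I = "vertex_pairs ?V"
  let ?S = "{X \<in> Pow ?V. X \<noteq> {} \<and> 4 * d * card X \<le> n}"
  let ?f = "\<lambda>v E. of_bool (1 + (1 + lam) * d \<le> card (nbhd E {v})) :: real"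
  let ?g = "\<lambda>X E. of_bool (card (nbhd E X) \<le> card X * d * (1 - lam - 2 * real (card X) * d / n)) :: real"
  have expL: "exp (- L) = 1 / n"
    using n by (simp add: L_def exp_minus inverse_eq_divide)
  have "bexp p ?I (\<lambda>E. of_bool (\<not> typical ?V d lam E)) \<le> bexp p ?I (\<lambda>E. (\<Sum>v\<in>?V. ?f v E) + (\<Sum>X\<in>?S. ?g X E))"
  proof (intro bexp_mono p01)
    fix E :: "nat set set"
    have 0: "0 \<le> (\<Sum>v\<in>?V. ?f v E)" "0 \<le> (\<Sum>X\<in>?S. ?g X E)"
      by (auto intro!: sum_nonneg)
    show "of_bool (\<not> typical ?V d lam E) \<le> (\<Sum>v\<in>?V. ?f v E) + (\<Sum>X\<in>?S. ?g X E)"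
    proof (cases "typical ?V d lam E")
      case False
      then have "(\<exists>v\<in>?V. 1 + (1 + lam) * d < card (nbhd E {v})) \<or>
          (\<exists>X\<in>?S. card (nbhd E X) < card X * d * (1 - lam - 2 * real (card X) * d / n))"
        by (auto simp: typical_def not_le)
      then consider v where "v \<in> ?V" "1 + (1 + lam) * d \<le> card (nbhd E {v})"
        | X where "X \<in> ?S" "card (nbhd E X) \<le> card X * d * (1 - lam - 2 * real (card X) * d / n)"
        using less_imp_le by blast
      then show ?thesis
      proof cases
        case 1
        then have "1 \<le> (\<Sum>v\<in>?V. ?f v E)"
          using member_le_sum[of v ?V "\<lambda>v. ?f v E"] by simp
        with 0 show ?thesis by simp
      next
        case 2
        then have "1 \<le> (\<Sum>X\<in>?S. ?g X E)"
          using member_le_sum[of X ?S "\<lambda>X. ?g X E"] by simp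
        with 0 show ?thesis by simp
      qed
    qed (use 0 in simp)
  qed
  also have "\<dots> = (\<Sum>v\<in>?V. bexp p ?I (?f v)) + (\<Sum>X\<in>?S. bexp p ?I (?g X))"
    by (simp only: bexp_add bexp_sum)
  also have "\<dots> \<le> (\<Sum>v\<in>?V. exp (- 4 * L)) + (\<Sum>X\<in>?S. exp (- L) * (1 / n) ^ card X)"
  proof (intro add_mono sum_mono degree_tail)
    fix X assume X: "X \<in> ?S"
    then have "finite X" "X \<noteq> {}" by (auto intro: finite_subset[OF _ finite_atLeastAtMost])
    then have x: "1 \<le> real (card X)" by (simp add: Suc_le_eq card_gt_0_iff)
    have "bexp p ?I (?g X) \<le> exp (- 8 * L * card X)"
      using X by (intro expansion_tail) auto
    also have "\<dots> \<le> exp (- L + card X * (- L))"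
    proof -
      have "L * 1 \<le> L * card X" using x L1 by (intro mult_left_mono) auto
      moreover have "0 \<le> L * card X" using L1 by simp
      ultimately show ?thesis by (simp add: mult.commute)
    qed
    also have "\<dots> = exp (- L) * (1 / n) ^ card X"
      by (simp only: exp_add exp_of_nat_mult expL)
    finally show "bexp p ?I (?g X) \<le> exp (- L) * (1 / n) ^ card X" .
  qed
  also have "(\<Sum>v\<in>?V. exp (- 4 * L)) \<le> 1 / n"
  proof -
    have "exp (- 4 * L) = exp (-L) ^ 4" by (simp flip: exp_of_nat_mult)
    then have "(\<Sum>v\<in>?V. exp (- 4 * L)) = 1 / real n ^ 3"
      using n by (simp add: expL field_simps power4_eq_xxxx power3_eq_cube)
    also have "\<dots> \<le> 1 / real n ^ 1"
      using n by (intro divide_left_mono power_increasing) auto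
    finally show ?thesis by simp
  qed
  also have "(\<Sum>X\<in>?S. exp (- L) * (1 / n) ^ card X) \<le> 3 / n"
  proof -
    have "(\<Sum>X\<in>?S. exp (- L) * (1 / n) ^ card X) \<le> (\<Sum>X\<in>Pow ?V. exp (- L) * (1 / n) ^ card X)"
      by (intro sum_mono2) auto
    \<comment> \<open>Expanding the product of n factors 1/n + 1 yields one term (1/n)^|X| for each
      subset \<open>X\<close>.\<close>
    also have "\<dots> = exp (- L) * (1 + 1 / n) ^ n"
      using prod_add[of ?V "\<lambda>_. 1 / real n" "\<lambda>_. 1"]
      by (simp add: add.commute flip: sum_distrib_left)
    also have "\<dots> \<le> exp (- L) * exp 1"
    proof -
      have "(1 + 1 / real n) ^ n \<le> exp (1 / n) ^ n"
        by (intro power_mono exp_ge_add_one_self) auto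
      also have "\<dots> = exp 1" using n by (simp flip: exp_of_nat_mult)
      finally show ?thesis by simp
    qed
    also have "\<dots> \<le> 3 / n"
      using exp_le by (simp add: expL divide_right_mono)
    finally show ?thesis .
  qed
  finally show ?thesis by simp
qed

end

section \<open>Staged exposure of the random graph\<close>

text \<open>Presented as a union of stars centred in \<open>B\<close>, because these stars are the
  independent blocks in the counting lemmas.\<close>

definition between :: "'a set \<Rightarrow> 'a set \<Rightarrow> 'a set set" where
  "between A B = (\<Union>b\<in>B. (\<lambda>a. {a, b}) ` A)"

lemma mem_between: "e \<in> between A B \<longleftrightarrow> (\<exists>a\<in>A. \<exists>b\<in>B. e = {a, b})"
  by (auto simp: between_def)

lemma disjoint_between:
  assumes "A \<inter> B = {}"
  shows "disjoint_family_on (\<lambda>b. (\<lambda>a. {a, b}) ` A) B"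
  using assms by (fastforce simp: disjoint_family_on_def doubleton_eq_iff)

lemma card_star: "b \<notin> A \<Longrightarrow> card ((\<lambda>a. {a, b}) ` A) = card A"
  by (intro card_image) (auto simp: inj_on_def doubleton_eq_iff)

lemma between_subset: "A \<subseteq> V \<Longrightarrow> B \<subseteq> V \<Longrightarrow> A \<inter> B = {} \<Longrightarrow> between A B \<subseteq> vertex_pairs V"
  by (auto simp: between_def vertex_pairs_def card_insert_if)

context graph_params
begin

text \<open>The part of the core whose pairs have all been inspected once the core is known. For i =
  1 the core is \<open>R\<close> itself and nothing has been inspected, whereas truncated
  subtraction would wrongly give the ball of radius 0.\<close>

definition inner :: "nat set \<Rightarrow> nat set set \<Rightarrow> nat set" where
  "inner R E = (if i = 1 then {} else gball E (i - 2) R)"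

definition core :: "nat set \<Rightarrow> nat set set \<Rightarrow> nat set" where
  "core R E = gball E (i - 1) R"

definition far :: "nat set \<Rightarrow> nat set set \<Rightarrow> nat set" where
  "far R E = {1..n} - gball E i R"

lemma nbhd_core: "nbhd E (core R E) = gball E i R"
  using i gball_Suc[of E "i - 1" R] by (simp add: core_def del: gball_Suc)

lemma nbhd_inner: "i \<noteq> 1 \<Longrightarrow> nbhd E (inner R E) = core R E"
proof -
  assume "i \<noteq> 1"
  then have "Suc (i - 2) = i - 1" using i by simp
  then show ?thesis
    using gball_Suc[of E "i - 2" R] \<open>i \<noteq> 1\<close> by (simp add: core_def inner_def del: gball_Suc)
qed

lemma inner_subset_core: "inner R E \<subseteq> core R E"
  using gball_incr[of "i - 2" "i - 1" E R] by (simp add: core_def inner_def)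

lemma core_subset: "R \<subseteq> {1..n} \<Longrightarrow> E \<subseteq> vertex_pairs {1..n} \<Longrightarrow> core R E \<subseteq> {1..n}"
  by (simp add: core_def gball_subset)

text \<open>The first exposure stage. Exploring the core inspects no pair between
  \<open>core R E - inner R E\<close> and the outside, and vertices outside the core have no
  neighbour in \<open>inner R E\<close>. Hence such a vertex is far if its star of uninspected pairs
  contains no edge, which has probability at least (1 - p)^w, independently for distinct
  vertices.\<close>

lemma far_tail:
  assumes R: "R \<subseteq> {1..n}"
  shows "bexp p (vertex_pairs {1..n}) (\<lambda>E. of_bool (card (core R E) \<le> w \<and> real (card (far R E)) \<le> y))
    \<le> exp (y - (real n - real w) * (1 - p) ^ w / 2)" (is "bexp p ?I ?f \<le> ?b")
proof -
  let ?G = "\<lambda>E. between (core R E - inner R E) ({1..n} - core R E)"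
  have G_sub: "?G E \<subseteq> ?I" if "E \<subseteq> ?I" for E
    using core_subset[OF R that] by (intro between_subset) auto
  have stop: "core R E' = core R E \<and> inner R E' = inner R E"
    if "E \<subseteq> ?I" "E' \<subseteq> ?I" "E' - ?G E = E - ?G E" for E E'
  proof (cases "i = 1")
    case False
    then have "i = Suc (Suc (i - 2))" using i by simp
    then obtain k where k: "i = Suc (Suc k)" by blast
    have "{x, v} \<in> E \<longleftrightarrow> {x, v} \<in> E'" if "x \<in> gball E k R" for x v
    proof -
      have "x \<in> inner R E" unfolding inner_def using that k by simp
      then have "{x, v} \<notin> ?G E"
        using inner_subset_core[of R E] by (auto simp: mem_between doubleton_eq_iff)
      then show ?thesis using \<open>E' - ?G E = E - ?G E\<close> by blast
    qed
    then have "gball E' j R = gball E j R" if "j \<le> Suc k" for j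
      using that by (rule gball_cong)
    then show ?thesis unfolding core_def inner_def using k by (simp del: gball_Suc)
  next
    case True
    then show ?thesis unfolding core_def inner_def by simp
  qed
  have "bexp p ?I ?f = bexp p ?I (\<lambda>E. bexp p (?G E) (\<lambda>S. ?f ((E - ?G E) \<union> S)))"
  proof (rule bexp_resample[OF finite_pairs G_sub])
    show "?G E' = ?G E" if "E \<subseteq> ?I" "E' \<subseteq> ?I" "E' - ?G E = E - ?G E" for E E'
      using stop[OF that] by simp
  qed
  also have "\<dots> \<le> bexp p ?I (\<lambda>E. ?b)"
  proof (intro bexp_mono p01)
    fix E assume E: "E \<subseteq> ?I"
    let ?W = "core R E" and ?N = "{1..n} - core R E"
    let ?B = "\<lambda>v. (\<lambda>a. {a, v}) ` (?W - inner R E)"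
    have W: "?W \<subseteq> {1..n}" "finite ?W"
      using core_subset[OF R E] by (auto intro: finite_subset)
    have *: "core R ((E - ?G E) \<union> S) = ?W" if "S \<subseteq> ?G E" for S
      using stop[OF E, of "(E - ?G E) \<union> S"] G_sub[OF E] that E by auto
    show "bexp p (?G E) (\<lambda>S. ?f ((E - ?G E) \<union> S)) \<le> ?b"
    proof (cases "card ?W \<le> w")
      case False
      then have "bexp p (?G E) (\<lambda>S. ?f ((E - ?G E) \<union> S)) = bexp p (?G E) (\<lambda>S. 0)"
        using * by (intro bexp_cong) simp
      then show ?thesis by (simp add: bexp_def)
    next
      case True
      have "bexp p (?G E) (\<lambda>S. ?f ((E - ?G E) \<union> S))
        \<le> bexp p (?G E) (\<lambda>S. of_bool (real (card {v \<in> ?N. S \<inter> ?B v = {}}) \<le> y))"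
      proof (intro bexp_mono p01)
        fix S assume S: "S \<subseteq> ?G E"
        let ?E = "(E - ?G E) \<union> S"
        have "{v \<in> ?N. S \<inter> ?B v = {}} \<subseteq> far R ?E"
        proof
          fix v assume v: "v \<in> {v \<in> ?N. S \<inter> ?B v = {}}"
          have "{x, v} \<notin> ?E" if x: "x \<in> ?W" for x
          proof (cases "x \<in> inner R E")
            case True
            then have "i \<noteq> 1" by (auto simp: inner_def)
            then have "v \<notin> nbhd E (inner R E)" using v nbhd_inner by simp
            then have "{x, v} \<notin> E" using True by (auto simp: nbhd_def)
            moreover have "{x, v} \<notin> ?G E"
              using True inner_subset_core[of R E] by (auto simp: mem_between doubleton_eq_iff)
            ultimately show ?thesis using S by blast
          next
            case False
            then have "{x, v} \<in> ?B v" using x by blast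
            moreover have "{x, v} \<in> ?G E" unfolding mem_between using False x v by blast
            ultimately show ?thesis using v by blast
          qed
          then have "v \<notin> nbhd ?E ?W" using v by (auto simp: nbhd_def)
          then show "v \<in> far R ?E"
            using v nbhd_core[of ?E R] *[OF S] by (auto simp: far_def)
        qed
        then have "card {v \<in> ?N. S \<inter> ?B v = {}} \<le> card (far R ?E)"
          by (intro card_mono) (auto simp: far_def)
        then show "?f ?E \<le> of_bool (real (card {v \<in> ?N. S \<inter> ?B v = {}}) \<le> y)"
          by auto
      qed
      \<comment> \<open>Chernoff's bound with \<theta> = 1, whence the factor 1/2 in the
        claim.\<close>
      also have "\<dots> \<le> exp (1 * y - card ?N * (1 - p) ^ w * (1 - 1\<^sup>2 / 2))"
      proof (rule bexp_count_lower_tail[where B = ?B and g = "\<lambda>v S. S = {}"])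
        show "finite (?G E)" using G_sub[OF E] finite_pairs by (rule finite_subset)
        show "?B v \<subseteq> ?G E" if "v \<in> ?N" for v using that by (auto simp: between_def)
        show "disjoint_family_on ?B ?N" by (rule disjoint_between) auto
        show "(1 - p) ^ w \<le> bexp p (?B v) (\<lambda>S. of_bool (S = {}))" if "v \<in> ?N" for v
        proof -
          have "card (?B v) \<le> w"
            using that True W card_mono[of ?W "?W - inner R E"] by (subst card_star) auto
          then have "(1 - p) ^ w \<le> (1 - p) ^ card (?B v)"
            using p by (intro power_decreasing) auto
          also have "\<dots> = bexp p (?B v) (\<lambda>S. of_bool (S \<inter> ?B v = {}))"
            using W by (subst bexp_avoid) auto
          also have "\<dots> = bexp p (?B v) (\<lambda>S. of_bool (S = {}))"
            by (intro bexp_cong) (simp add: Int_absorb2)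
          finally show ?thesis .
        qed
      qed (use p in auto)
      also have "\<dots> \<le> ?b"
      proof -
        have "card ?W + card ?N = n"
          using W by (simp add: card_Diff_subset card_mono[OF _ W(1), simplified])
        then have "real n - real w \<le> card ?N"
          using True by linarith
        then have "(real n - real w) * (1 - p) ^ w \<le> card ?N * (1 - p) ^ w"
          using p by (intro mult_right_mono) auto
        then show ?thesis by simp
      qed
      finally show ?thesis .
    qed
  qed
  also have "\<dots> = ?b" using finite_pairs by simp
  finally show ?thesis .
qed

text \<open>Only \<open>m\<close> of the far vertices are used, so that \<open>rest\<close> keeps
  most of the vertex set even when almost all vertices are far. The choice depends on
  \<open>E\<close> only through \<open>far R E\<close> and therefore survives resampling of the
  last-stage pairs.\<close>

definition chosen :: "nat \<Rightarrow> nat set \<Rightarrow> nat set set \<Rightarrow> nat set" where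
  "chosen m R E = (if m \<le> card (far R E) then SOME A. A \<subseteq> far R E \<and> card A = m else {})"

definition rest :: "nat \<Rightarrow> nat set \<Rightarrow> nat set set \<Rightarrow> nat set" where
  "rest m R E = {1..n} - core R E - chosen m R E"

definition heavy :: "nat set \<Rightarrow> nat set set \<Rightarrow> nat set" where
  "heavy R E = {r \<in> R. d ^ i / 2 \<le> card (gball E i {r} \<inter> core R E)}"

text \<open>A chosen vertex adjacent to the target of \<open>r\<close> is at distance i + 1 from
  \<open>r\<close> if \<open>r\<close> is light, and i + 1 or i + 2 if \<open>r\<close> is heavy.
  The core is left out because its pairs with far vertices are already known to be non-edges. For
  heavy \<open>r\<close> too little of the \<open>i\<close>-ball then remains, so the radius is
  increased by one.\<close>

definition target :: "nat \<Rightarrow> nat set \<Rightarrow> nat set set \<Rightarrow> nat \<Rightarrow> nat set" where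
  "target m R E r = (if r \<in> heavy R E then rest m R E \<inter> nbhd E (gball E i {r}) else gball E i {r} - core R E)"

lemma chosen:
  assumes "m \<le> card (far R E)"
  shows "chosen m R E \<subseteq> far R E" "card (chosen m R E) = m"
proof -
  have "\<exists>A. A \<subseteq> far R E \<and> card A = m"
    using assms by (meson obtain_subset_with_card_n)
  then have "(SOME A. A \<subseteq> far R E \<and> card A = m) \<subseteq> far R E \<and> card (SOME A. A \<subseteq> far R E \<and> card A = m) = m"
    by (rule someI_ex)
  then show "chosen m R E \<subseteq> far R E" "card (chosen m R E) = m"
    using assms by (simp_all add: chosen_def)
qed

lemma chosen_subset_far: "chosen m R E \<subseteq> far R E"
  using chosen[of m R E] by (cases "m \<le> card (far R E)") (simp_all add: chosen_def)

lemma chosen_disjoint: "chosen m R E \<inter> gball E i R = {}" "chosen m R E \<inter> core R E = {}"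
  using chosen_subset_far[of m R E] gball_incr[of "i - 1" i E R] by (auto simp: far_def core_def)

lemma chosen_subset: "chosen m R E \<subseteq> {1..n}"
  using chosen_subset_far[of m R E] by (auto simp: far_def)

text \<open>The last-stage pairs join \<open>rest\<close> to \<open>chosen\<close>. Both sets avoid
  the core, and \<open>i\<close>-balls around elements of \<open>R\<close> are determined by the
  pairs that meet the core.\<close>

lemma last_stage_cong:
  assumes "r \<in> R" "E' - between (rest m R E) (chosen m R E) = E - between (rest m R E) (chosen m R E)"
  shows "gball E' i {r} = gball E i {r}" "gball E' i R = gball E i R" "core R E' = core R E"
proof -
  obtain k where k: "i = Suc k" using i by (cases i) auto
  have edge: "{x, v} \<in> E \<longleftrightarrow> {x, v} \<in> E'" if "x \<in> gball E k R" for x v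
  proof -
    have "x \<in> core R E" unfolding core_def using that k by simp
    then have "{x, v} \<notin> between (rest m R E) (chosen m R E)"
      using chosen_disjoint[of m R E] by (auto simp: mem_between doubleton_eq_iff rest_def)
    then show ?thesis using assms(2) by blast
  qed
  have eq: "gball E' j R = gball E j R" if "j \<le> Suc k" for j
    using edge that by (rule gball_cong)
  show "gball E' i R = gball E i R" "core R E' = core R E"
    unfolding core_def using eq k by (simp_all del: gball_Suc)
  have "gball E k {r} \<subseteq> gball E k R"
    using assms(1) by (intro gball_mono) simp
  then have "gball E' (Suc k) {r} = gball E (Suc k) {r}"
    using edge by (intro gball_cong) auto
  then show "gball E' i {r} = gball E i {r}" using k by simp
qed

text \<open>Vertices that hit all targets have distance exactly i + 1 to every light element and one
  of two distances to every heavy one. With more such vertices than subsets of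
  \<open>heavy R E\<close>, two of them share all distances.\<close>

lemma not_resolvingI:
  assumes E: "E \<subseteq> vertex_pairs {1..n}" and R: "R \<subseteq> {1..n}"
    and S: "S \<subseteq> between (rest m R E) (chosen m R E)"
    and many: "2 ^ card (heavy R E) < card {v \<in> chosen m R E. \<forall>r\<in>R. \<exists>z\<in>target m R E r. {z, v} \<in> S}"
  shows "\<not> resolving {1..n} ((E - between (rest m R E) (chosen m R E)) \<union> S) R"
proof -
  let ?G = "between (rest m R E) (chosen m R E)"
  let ?good = "{v \<in> chosen m R E. \<forall>r\<in>R. \<exists>z\<in>target m R E r. {z, v} \<in> S}"
  define E' where "E' = (E - ?G) \<union> S"
  have diff: "E' - ?G = E - ?G" using S by (auto simp: E'_def)
  have finR: "finite R" using R by (rule finite_subset) simp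
  then have finH: "finite (heavy R E)" by (simp add: heavy_def)
  have far: "v \<notin> gball E' i {r}" if "v \<in> ?good" "r \<in> R" for v r
    using that last_stage_cong(1)[OF that(2) diff] chosen_disjoint(1)[of m R E] gball_mono[of "{r}" R E i]
    by auto
  have light: "graph_dist E' v r = enat (Suc i)" if v: "v \<in> ?good" and r: "r \<in> R" "r \<notin> heavy R E" for v r
  proof (rule graph_dist_eqI[OF _ far[OF v r(1)]])
    obtain z where z: "z \<in> target m R E r" "{z, v} \<in> S" using v r(1) by blast
    then have "z \<in> gball E i {r}" using r(2) by (simp add: target_def)
    then show "v \<in> gball E' (Suc i) {r}"
      using z(2) last_stage_cong(1)[OF r(1) diff] by (auto simp: nbhd_def E'_def)
  qed
  have hv: "graph_dist E' v r = enat (Suc i) \<or> graph_dist E' v r = enat (Suc (Suc i))"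
    if v: "v \<in> ?good" and r: "r \<in> heavy R E" for v r
  proof -
    have rR: "r \<in> R" using r by (simp add: heavy_def)
    obtain z where z: "z \<in> target m R E r" "{z, v} \<in> S" using v rR by blast
    then have zr: "z \<in> rest m R E" "z \<in> nbhd E (gball E i {r})" using r by (auto simp: target_def)
    have "z \<in> nbhd E' (gball E i {r})"
    proof (cases "z \<in> gball E i {r}")
      case False
      then obtain x where x: "x \<in> gball E i {r}" "{x, z} \<in> E"
        using zr(2) by (auto simp: nbhd_def)
      \<comment> \<open>The edge from the ball of \<open>r\<close> to \<open>z\<close> is not
        affected by resampling, since neither of its ends is a chosen vertex.\<close>
      have "gball E i {r} \<subseteq> gball E i R" using rR by (intro gball_mono) simp
      then have "x \<notin> chosen m R E"
        using x(1) chosen_disjoint(1)[of m R E] by blast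
      then have "{x, z} \<notin> ?G"
        using zr(1) by (auto simp: mem_between doubleton_eq_iff rest_def)
      then have "{x, z} \<in> E'" using x(2) by (simp add: E'_def)
      then show ?thesis using x(1) by (auto simp: nbhd_def)
    qed (auto simp: nbhd_def)
    then have "z \<in> gball E' (Suc i) {r}"
      using last_stage_cong(1)[OF rR diff] by simp
    then have "v \<in> gball E' (Suc (Suc i)) {r}"
      using z(2) by (auto simp: nbhd_def E'_def)
    then show ?thesis
      using graph_dist_eqI[of v E' i r] graph_dist_eqI[of v E' "Suc i" r] far[OF v rR]
      by (cases "v \<in> gball E' (Suc i) {r}") simp_all
  qed
  \<comment> \<open>The pattern of distances to the heavy elements, as a subset of
    \<open>heavy R E\<close>: the pigeonholes.\<close>
  let ?F = "\<lambda>v. {r \<in> heavy R E. graph_dist E' v r = enat (Suc i)}"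
  have "\<not> inj_on ?F ?good"
  proof
    assume "inj_on ?F ?good"
    then have "card ?good \<le> card (Pow (heavy R E))"
      using finH by (intro card_inj_on_le[of ?F]) auto
    then show False using many finH by (simp add: card_Pow)
  qed
  then obtain v w where vw: "v \<in> ?good" "w \<in> ?good" "v \<noteq> w" "?F v = ?F w"
    by (auto simp: inj_on_def)
  have "graph_dist E' v r = graph_dist E' w r" if "r \<in> R" for r
  proof (cases "r \<in> heavy R E")
    case True
    have "graph_dist E' v r = enat (Suc i) \<longleftrightarrow> graph_dist E' w r = enat (Suc i)"
      using vw(4) True by blast
    then show ?thesis using hv[OF vw(1) True] hv[OF vw(2) True] by auto
  qed (use light vw that in simp)
  then have "dist_vector E' R v = dist_vector E' R w"
    by (auto simp: dist_vector_def)
  moreover have "v \<in> {1..n}" "w \<in> {1..n}" using vw chosen_subset[of m R E] by auto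
  ultimately show ?thesis
    using vw(3) unfolding resolving_def E'_def by blast
qed

lemma target_subset:
  assumes "R \<subseteq> {1..n}" "E \<subseteq> vertex_pairs {1..n}" "r \<in> R"
  shows "target m R E r \<subseteq> rest m R E"
proof -
  have "{r} \<subseteq> {1..n}" using assms(1,3) by blast
  then have "gball E i {r} \<subseteq> {1..n}" by (rule gball_subset[OF assms(2)])
  moreover have "gball E i {r} \<inter> chosen m R E = {}"
    using chosen_disjoint(1)[of m R E] gball_mono[of "{r}" R E i] assms(3) by blast
  ultimately show ?thesis
    unfolding target_def rest_def by auto
qed

text \<open>The last exposure stage. Given all pairs except those between \<open>rest\<close> and
  \<open>chosen\<close>, the chosen vertices hit all their targets independently of each other, each
  with probability at least \<open>q\<close> by Harris' inequality. A resolving \<open>R\<close>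
  allows at most \<open>M\<close> such vertices, and Chernoff's bound with \<theta> = 1
  applies.\<close>

lemma resolving_tail:
  assumes R: "R \<subseteq> {1..n}" and q: "0 \<le> q"
    and bound: "\<And>E. E \<subseteq> vertex_pairs {1..n} \<Longrightarrow> typical {1..n} d lam E \<Longrightarrow> m \<le> card (far R E) \<Longrightarrow>
       2 ^ card (heavy R E) \<le> M \<and> q \<le> (\<Prod>r\<in>R. 1 - (1 - p) ^ card (target m R E r))"
  shows "bexp p (vertex_pairs {1..n})
      (\<lambda>E. of_bool (typical {1..n} d lam E \<and> m \<le> card (far R E) \<and> resolving {1..n} E R))
    \<le> exp (M - m * q / 2)" (is "bexp p ?I ?f \<le> ?b")
proof -
  let ?G = "\<lambda>E. between (rest m R E) (chosen m R E)"
  have finR: "finite R" using R by (rule finite_subset) simp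
  have G_sub: "?G E \<subseteq> ?I" if "E \<subseteq> ?I" for E
    using chosen_subset[of m R E] by (intro between_subset) (auto simp: rest_def)
  have stop: "far R E' = far R E \<and> ?G E' = ?G E" if "E' - ?G E = E - ?G E" for E E'
  proof (cases "R = {}")
    \<comment> \<open>\<open>last_stage_cong\<close> is stated relative to an element of
      \<open>R\<close>; for empty \<open>R\<close> all balls are empty.\<close>
    case True
    have "gball X k {} = {}" for X :: "nat set set" and k
      by (induction k) (simp_all add: nbhd_def)
    then show ?thesis using True by (simp add: far_def rest_def chosen_def core_def)
  next
    case False
    then obtain r where r: "r \<in> R" by blast
    show ?thesis
      using last_stage_cong(2,3)[OF r that] by (simp add: far_def rest_def chosen_def)
  qed
  have key: "bexp p (?G E) (\<lambda>S. of_bool (resolving {1..n} ((E - ?G E) \<union> S) R)) \<le> ?b"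
    if E: "E \<subseteq> ?I" and ty: "typical {1..n} d lam E" and m: "m \<le> card (far R E)" for E
  proof -
    let ?B = "\<lambda>v. (\<lambda>z. {z, v}) ` rest m R E"
    let ?g = "\<lambda>v S. \<forall>r\<in>R. S \<inter> (\<lambda>z. {z, v}) ` target m R E r \<noteq> {}"
    have fin: "finite (chosen m R E)" "finite (rest m R E)"
      using chosen_subset[of m R E] by (auto simp: rest_def intro: finite_subset)
    have tsub: "(\<lambda>z. {z, v}) ` target m R E r \<subseteq> ?B v" if "r \<in> R" for r v
      using target_subset[OF R E that] by (rule image_mono)
    have "bexp p (?G E) (\<lambda>S. of_bool (resolving {1..n} ((E - ?G E) \<union> S) R))
      \<le> bexp p (?G E) (\<lambda>S. of_bool (real (card {v \<in> chosen m R E. ?g v (S \<inter> ?B v)}) \<le> M))"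
    proof (intro bexp_mono p01)
      fix S assume S: "S \<subseteq> ?G E"
      have eq: "{v \<in> chosen m R E. ?g v (S \<inter> ?B v)}
          = {v \<in> chosen m R E. \<forall>r\<in>R. \<exists>z\<in>target m R E r. {z, v} \<in> S}"
        using tsub by blast
      have "real (card {v \<in> chosen m R E. ?g v (S \<inter> ?B v)}) \<le> M"
        if "resolving {1..n} ((E - ?G E) \<union> S) R"
      proof -
        have "card {v \<in> chosen m R E. ?g v (S \<inter> ?B v)} \<le> 2 ^ card (heavy R E)"
        proof (rule ccontr)
          assume "\<not> ?thesis"
          then have "2 ^ card (heavy R E) < card {v \<in> chosen m R E. \<forall>r\<in>R. \<exists>z\<in>target m R E r. {z, v} \<in> S}"
            by (simp only: eq not_le)
          from not_resolvingI[OF E R S this] that show False by contradiction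
        qed
        then have "real (card {v \<in> chosen m R E. ?g v (S \<inter> ?B v)}) \<le> real (2 ^ card (heavy R E))"
          by (rule of_nat_mono)
        also have "\<dots> = 2 ^ card (heavy R E)"
          by simp
        also have "\<dots> \<le> M"
          using bound[OF E ty m] by blast
        finally show ?thesis .
      qed
      then show "of_bool (resolving {1..n} ((E - ?G E) \<union> S) R)
        \<le> (of_bool (real (card {v \<in> chosen m R E. ?g v (S \<inter> ?B v)}) \<le> M) :: real)"
        by auto
    qed
    also have "\<dots> \<le> exp (1 * M - card (chosen m R E) * q * (1 - 1\<^sup>2 / 2))"
    proof (rule bexp_count_lower_tail[where B = ?B and g = ?g])
      show "finite (?G E)" using G_sub[OF E] finite_pairs by (rule finite_subset)
      show "?B v \<subseteq> ?G E" if "v \<in> chosen m R E" for v using that by (auto simp: between_def)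
      show "disjoint_family_on ?B (chosen m R E)" by (rule disjoint_between) (auto simp: rest_def)
      show "q \<le> bexp p (?B v) (\<lambda>S. of_bool (?g v S))" if v: "v \<in> chosen m R E" for v
      proof -
        have "card ((\<lambda>z. {z, v}) ` target m R E r) = card (target m R E r)" if "r \<in> R" for r
          using v target_subset[OF R E that] by (intro card_star) (auto simp: rest_def)
        then have "(\<Prod>r\<in>R. 1 - (1 - p) ^ card (target m R E r))
            = (\<Prod>r\<in>R. 1 - (1 - p) ^ card ((\<lambda>z. {z, v}) ` target m R E r))"
          by (intro prod.cong) simp_all
        also have "\<dots> \<le> bexp p (?B v) (\<lambda>S. of_bool (?g v S))"
          using fin p01 finR tsub by (intro bexp_hit_all) auto
        finally show ?thesis using bound[OF E ty m] by linarith
      qed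
    qed (use p q fin in auto)
    also have "\<dots> = ?b" using chosen(2)[OF m] by simp
    finally show ?thesis .
  qed
  have "bexp p ?I ?f = bexp p ?I (\<lambda>E. bexp p (?G E) (\<lambda>S. ?f ((E - ?G E) \<union> S)))"
  proof (rule bexp_resample[OF finite_pairs G_sub])
    show "?G E' = ?G E" if "E \<subseteq> ?I" "E' \<subseteq> ?I" "E' - ?G E = E - ?G E" for E E'
      using stop[OF that(3)] by blast
  qed
  also have "\<dots> \<le> bexp p ?I (\<lambda>E. ?b)"
  proof (intro bexp_mono p01)
    fix E assume E: "E \<subseteq> ?I"
    show "bexp p (?G E) (\<lambda>S. ?f ((E - ?G E) \<union> S)) \<le> ?b"
    \<comment> \<open>Typicality also depends on the pairs still to be exposed, so \<open>E\<close>
      itself need not be typical. If some completion \<open>E0\<close> of the exposed part is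
      typical and has enough far vertices, the conditional bound is computed from \<open>E0\<close>;
      otherwise the integrand vanishes.\<close>
    proof (cases "\<exists>S\<subseteq>?G E. typical {1..n} d lam ((E - ?G E) \<union> S) \<and> m \<le> card (far R ((E - ?G E) \<union> S))")
      case False
      then have "?f ((E - ?G E) \<union> S) = 0" if "S \<subseteq> ?G E" for S
        using that unfolding of_bool_eq_0_iff by blast
      then have "bexp p (?G E) (\<lambda>S. ?f ((E - ?G E) \<union> S)) = bexp p (?G E) (\<lambda>S. 0)"
        by (intro bexp_cong)
      then show ?thesis by (simp add: bexp_def)
    next
      case True
      then obtain S0 where S0: "S0 \<subseteq> ?G E" "typical {1..n} d lam ((E - ?G E) \<union> S0)"
          "m \<le> card (far R ((E - ?G E) \<union> S0))"
        by blast
      define E0 where "E0 = (E - ?G E) \<union> S0"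
      have diff: "E0 - ?G E = E - ?G E" using S0(1) by (auto simp: E0_def)
      have GE: "?G E0 = ?G E" using stop[OF diff] by simp
      have "bexp p (?G E) (\<lambda>S. ?f ((E - ?G E) \<union> S))
        \<le> bexp p (?G E) (\<lambda>S. of_bool (resolving {1..n} ((E - ?G E) \<union> S) R))"
        by (rule bexp_mono[OF p01]) (unfold of_bool_def, simp)
      also have "\<dots> = bexp p (?G E0) (\<lambda>S. of_bool (resolving {1..n} ((E0 - ?G E0) \<union> S) R))"
        unfolding GE diff ..
      also have "\<dots> \<le> ?b"
        using S0 G_sub[OF E] E by (intro key) (auto simp: E0_def)
      finally show ?thesis .
    qed
  qed
  also have "\<dots> = ?b" using finite_pairs by simp
  finally show ?thesis .
qed

end

section \<open>Resolving sets of fixed size\<close>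

lemma exp_neg_le_one_minus:
  fixes x :: real
  assumes "0 \<le> x" "x \<le> 1 / 2"
  shows "exp (- x - 2 * x\<^sup>2) \<le> 1 - x"
proof -
  have "- x - 2 * x\<^sup>2 \<le> ln (1 - x)"
    using assms by (rule ln_one_minus_pos_lower_bound)
  then have "exp (- x - 2 * x\<^sup>2) \<le> exp (ln (1 - x))"
    by simp
  then show ?thesis using assms by simp
qed

lemma power_one_minus_le_exp:
  fixes p :: real
  assumes "p \<le> 1"
  shows "(1 - p) ^ k \<le> exp (- (p * k))"
proof -
  have "(1 - p) ^ k \<le> exp (- p) ^ k"
    using assms exp_ge_add_one_self[of "- p"] by (intro power_mono) auto
  also have "\<dots> = exp (- (p * k))"
    by (simp add: mult.commute flip: exp_of_nat_mult)
  finally show ?thesis .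
qed

text \<open>Here \<open>s\<close> is the size of \<open>R\<close>, and exp(G L) = n^G will be a
  lower bound for n times the two success probabilities of the stages; 9 \<kappa> is the total
  allowance for errors in the exponent. The threshold \<tau> singles out elements of
  \<open>R\<close> whose balls lose more than a share \<tau> to the core; for light elements below
  it, the probability of missing the target is at most exp(-(c (1 - eta - \<tau>))). The conditions
  \<open>G_large\<close> make n^G exceed the number of pigeonholes and the logarithm of the number
  of sets \<open>R\<close>.\<close>

locale landmark_params = graph_params n i p d c L \<kappa> lam K mu eta
  for n i :: nat and p d c L \<kappa> lam K mu eta :: real +
  fixes s m :: nat and \<tau> \<epsilon> G :: real
  assumes s: "real s * (d ^ i / n + exp (- c)) \<le> (real i / real (i + 1) - \<epsilon>) * L"
    and G: "G = 1 / real (i + 1) + \<epsilon> - 9 * \<kappa>" and \<epsilon>: "0 \<le> \<epsilon>"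
    and m: "m = nat \<lfloor>n * exp (- ((1 + \<kappa>) * s * (d ^ i / n))) / 100\<rfloor>"
    and dL: "200 * L \<le> d" and d40: "40 \<le> d" and c_large: "exp (- (c / 4)) \<le> \<kappa>\<^sup>2 / 4" "8 \<le> \<kappa> * c"
    and \<tau>: "4 * eta \<le> \<tau>" "\<kappa> \<le> c * \<tau>" "exp (- (c * (1 - eta - \<tau>))) \<le> (1 + 2 * \<kappa>) * exp (- c) + \<kappa> * c / d"
    and p_small: "(1 + 2 * p) * (1 + eta) * n \<le> (1 + \<kappa>) * (real n - 1)"
    and G_large: "800 * exp (\<kappa> * L) \<le> exp (G * L)" "1600 * (d * L\<^sup>2 / c) \<le> exp (G * L)" "1600 * L \<le> exp (G * L)"
begin

lemma s_le: "s \<le> d * L / c"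
proof -
  have "s * (d ^ i / n) \<le> s * (d ^ i / n + exp (- c))"
    by (intro mult_left_mono) auto
  also have "\<dots> \<le> 1 * L"
  proof -
    have "real i / real (i + 1) - \<epsilon> \<le> 1" using \<epsilon> by (simp add: field_simps)
    then have "(real i / real (i + 1) - \<epsilon>) * L \<le> 1 * L" using L1 by (intro mult_right_mono) auto
    with s show ?thesis by linarith
  qed
  finally have "s * (c / d) \<le> L" using n by (simp add: d_pow_i)
  then show ?thesis using c1 d1 by (simp add: field_simps)
qed

lemma sL_le: "1600 * (s * L) \<le> exp (G * L)"
proof -
  have "s * L \<le> d * L / c * L" using s_le L1 by (intro mult_right_mono) auto
  also have "\<dots> = d * L\<^sup>2 / c" by (simp add: power2_eq_square)
  finally show ?thesis using G_large(2) by linarith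
qed

lemma d_pow_pred: "d * d ^ (i - 1) = d ^ i"
  using i by (simp flip: power_Suc)

lemma m_le: "m \<le> n * exp (- ((1 + \<kappa>) * s * (d ^ i / n))) / 100"
  unfolding m by (intro of_nat_floor) simp

lemma m_le': "m \<le> n / 100"
proof -
  have "n * exp (- ((1 + \<kappa>) * s * (d ^ i / n))) \<le> real n * 1"
    using \<kappa> d1 by (intro mult_left_mono) auto
  with m_le show ?thesis by simp
qed

text \<open>Bookkeeping of exponents in units of L = ln n: the two stages together cost at most
  i/(i+1) - \<epsilon> + 4 \<kappa>, the exceptional elements of \<open>R\<close> cost 5 \<kappa>,
  and what remains of 1 is \<open>G\<close>.\<close>

lemma exp_GL_le: "exp (G * L) \<le> n * exp (- ((1 + \<kappa>) * s * (d ^ i / n))) * exp (- (5 * \<kappa> * L) - (1 + 4 * \<kappa>) * (s * exp (- c)))"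
proof -
  have "(1 + 4 * \<kappa>) * (real s * (d ^ i / n + exp (- c))) \<le> (1 + 4 * \<kappa>) * ((real i / real (i + 1) - \<epsilon>) * L)"
    using s \<kappa> by (intro mult_left_mono) auto
  moreover have "(1 + \<kappa>) * (s * (d ^ i / n)) \<le> (1 + 4 * \<kappa>) * (s * (d ^ i / n))"
    using \<kappa> d1 by (intro mult_right_mono) auto
  moreover have "(1 + 4 * \<kappa>) * (real i / real (i + 1) - \<epsilon>) \<le> real i / real (i + 1) - \<epsilon> + 4 * \<kappa>"
  proof -
    have "4 * \<kappa> * (real i / real (i + 1) - \<epsilon>) \<le> 4 * \<kappa> * 1"
      using \<kappa> \<epsilon> by (intro mult_left_mono) (auto simp: field_simps)
    then show ?thesis by (simp add: algebra_simps)
  qed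
  then have "(1 + 4 * \<kappa>) * (real i / real (i + 1) - \<epsilon>) * L \<le> (real i / real (i + 1) - \<epsilon> + 4 * \<kappa>) * L"
    using L1 by (intro mult_right_mono) auto
  ultimately have "(1 + \<kappa>) * (s * (d ^ i / n)) + (1 + 4 * \<kappa>) * (s * exp (- c)) \<le> (real i / real (i + 1) - \<epsilon> + 4 * \<kappa>) * L"
    by (simp add: distrib_left mult.assoc)
  moreover have "G * L + (real i / real (i + 1) - \<epsilon> + 4 * \<kappa>) * L = L - 5 * \<kappa> * L"
  proof -
    have "1 / real (i + 1) + real i / real (i + 1) = 1" by (simp add: field_simps)
    then have "G + (real i / real (i + 1) - \<epsilon> + 4 * \<kappa>) = 1 - 5 * \<kappa>"
      unfolding G by linarith
    then have "(G + (real i / real (i + 1) - \<epsilon> + 4 * \<kappa>)) * L = (1 - 5 * \<kappa>) * L"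
      by simp
    then show ?thesis by (simp add: algebra_simps)
  qed
  ultimately have "G * L \<le> L + (- ((1 + \<kappa>) * s * (d ^ i / n))) + (- (5 * \<kappa> * L) - (1 + 4 * \<kappa>) * (s * exp (- c)))"
    by (simp add: mult.assoc)
  then have "exp (G * L) \<le> exp (L + (- ((1 + \<kappa>) * s * (d ^ i / n))) + (- (5 * \<kappa> * L) - (1 + 4 * \<kappa>) * (s * exp (- c))))"
    by simp
  also have "\<dots> = n * exp (- ((1 + \<kappa>) * s * (d ^ i / n))) * exp (- (5 * \<kappa> * L) - (1 + 4 * \<kappa>) * (s * exp (- c)))"
    using n by (simp only: exp_add) (simp add: L_def)
  finally show ?thesis .
qed

text \<open>A threshold for the core that does not depend on the graph, as \<open>far_tail\<close>
  requires; \<open>card_core_le\<close> shows that typical graphs respect it.\<close>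

definition core_bound :: nat where
  "core_bound = nat \<lfloor>s * d ^ (i - 1) * (1 + eta)\<rfloor>"

lemma core_bound_le: "core_bound \<le> s * d ^ (i - 1) * (1 + eta)"
  unfolding core_bound_def using d1 imu by (intro of_nat_floor) simp

lemma core_bound_le': "core_bound \<le> 2 * d ^ i * L / c"
proof -
  have "s * d ^ (i - 1) * (1 + eta) \<le> d * L / c * d ^ (i - 1) * 2"
    using s_le d1 c1 L1 eta imu by (intro mult_mono) auto
  also have "\<dots> = 2 * (d * d ^ (i - 1)) * L / c" by simp
  finally show ?thesis using core_bound_le d_pow_pred by simp
qed

lemma core_bound_le'': "core_bound \<le> n / 100"
proof -
  have "2 * d ^ i * L / c = 2 * L * n / d"
    using c1 by (simp add: d_pow_i)
  also have "\<dots> \<le> n / 100"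
    using dL d1 mult_right_mono[OF dL, of "real n"] by (simp add: field_simps)
  finally show ?thesis using core_bound_le' by linarith
qed

text \<open>Since 1 - p \<ge> exp(-p - 2 p^2) and p = d / (n - 1), the exponent is s d^i / n up to
  the factor (1 + 2 p) (1 + eta) n / (n - 1), which \<open>p_small\<close> bounds by 1 +
  \<kappa>.\<close>

lemma avoid_core_ge: "exp (- ((1 + \<kappa>) * s * (d ^ i / n))) \<le> (1 - p) ^ core_bound"
proof -
  have "(p + 2 * p\<^sup>2) * core_bound \<le> (1 + \<kappa>) * s * (d ^ i / n)"
  proof -
    have "d / (real n - 1) = p" using n by (simp add: d_def)
    then have pq: "p + 2 * p\<^sup>2 = d / (real n - 1) * (1 + 2 * p)"
      by (simp add: power2_eq_square algebra_simps)
    have "(p + 2 * p\<^sup>2) * core_bound \<le> (p + 2 * p\<^sup>2) * (s * d ^ (i - 1) * (1 + eta))"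
      using core_bound_le p by (intro mult_left_mono) auto
    also have "(p + 2 * p\<^sup>2) * (s * d ^ (i - 1) * (1 + eta)) = s * (d * d ^ (i - 1)) / ((real n - 1) * n) * ((1 + 2 * p) * (1 + eta) * n)"
      unfolding pq using n by (simp add: field_simps)
    also have "\<dots> \<le> s * (d * d ^ (i - 1)) / ((real n - 1) * n) * ((1 + \<kappa>) * (real n - 1))"
      using p_small n d1 by (intro mult_left_mono) auto
    also have "\<dots> = (1 + \<kappa>) * s * (d ^ i / n)"
      unfolding d_pow_pred using n by simp
    finally show ?thesis .
  qed
  then have "exp (- ((1 + \<kappa>) * s * (d ^ i / n))) \<le> exp (core_bound * (- p - 2 * p\<^sup>2))"
    by (simp add: algebra_simps)
  also have "\<dots> = exp (- p - 2 * p\<^sup>2) ^ core_bound"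
    by (rule exp_of_nat_mult)
  also have "\<dots> \<le> (1 - p) ^ core_bound"
    using p by (intro power_mono exp_neg_le_one_minus) auto
  finally show ?thesis .
qed

lemma p_d_pow: "c \<le> p * d ^ i"
proof -
  have "d / n \<le> p" using p n by (simp add: d_def field_simps)
  then have "d / n * d ^ i \<le> p * d ^ i" using d1 by (intro mult_right_mono) auto
  then show ?thesis by (simp add: c_def)
qed

lemma card_core_le:
  assumes "E \<subseteq> vertex_pairs {1..n}" "typical {1..n} d lam E" "R \<subseteq> {1..n}" "card R = s"
  shows "card (core R E) \<le> core_bound"
proof -
  interpret typical_graph n i p d c L \<kappa> lam K mu eta E
    using assms(1,2) by unfold_locales
  have "card (core R E) \<le> s * d ^ (i - 1) * (1 + eta)"
    using card_gball_le[OF assms(3), of "i - 1"] assms(4) by (simp add: core_def)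
  then show ?thesis unfolding core_bound_def by (rule le_nat_floor)
qed

lemma card_heavy_tau:
  fixes t :: real
  assumes Et: "E \<subseteq> vertex_pairs {1..n}" "typical {1..n} d lam E" and R: "R \<subseteq> {1..n}" "card R = s"
    and t: "4 * eta \<le> t" "\<kappa> \<le> c * t"
  shows "card {r \<in> R. t * d ^ i \<le> card (gball E i {r} \<inter> core R E)} \<le> 4 * L / (c * t)"
proof -
  interpret typical_graph n i p d c L \<kappa> lam K mu eta E
    using Et by unfold_locales
  have "card (core R E) \<le> 2 * d ^ i * L / c"
    using card_core_le[OF Et R] core_bound_le' by linarith
  moreover have "finite (core R E)"
    using core_subset[OF R(1) Et(1)] by (rule finite_subset) simp
  ultimately show ?thesis
    using R(1) t by (intro card_heavy_le)
qed

lemma card_heavy_le':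
  assumes "E \<subseteq> vertex_pairs {1..n}" "typical {1..n} d lam E" "R \<subseteq> {1..n}" "card R = s"
  shows "card (heavy R E) \<le> \<kappa> * L"
proof -
  have "4 * eta \<le> 1 / 2" "\<kappa> \<le> c * (1 / 2)"
    using eta \<kappa> c1 by linarith+
  from card_heavy_tau[OF assms this] have "card (heavy R E) \<le> 4 * L / (c * (1 / 2))"
    by (simp add: heavy_def)
  also have "\<dots> \<le> \<kappa> * L"
    using c_large(2) c1 L1 mult_right_mono[OF c_large(2), of L] by (simp add: field_simps)
  finally show ?thesis .
qed

text \<open>There are three kinds of elements of \<open>R\<close>. Heavy ones, at most \<kappa> L
  many, contribute factors of at least 1/2. Light ones above the threshold \<tau> number at most 4 L
  / \<kappa> and fail with probability at most exp(-c/4) \<le> \<kappa>^2 / 4. The others fail with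
  probability at most \<open>?x\<close>, which is close to exp(-c).\<close>

lemma target_prod_ge:
  assumes Et: "E \<subseteq> vertex_pairs {1..n}" "typical {1..n} d lam E" and R: "R \<subseteq> {1..n}" "card R = s"
    and far: "m \<le> card (far R E)"
  shows "exp (- (5 * \<kappa> * L) - (1 + 4 * \<kappa>) * (s * exp (- c))) \<le> (\<Prod>r\<in>R. 1 - (1 - p) ^ card (target m R E r))"
proof -
  interpret typical_graph n i p d c L \<kappa> lam K mu eta E
    using Et by unfold_locales
  have finR: "finite R" using R(1) by (rule finite_subset) simp
  let ?H = "{r \<in> R. \<tau> * d ^ i \<le> card (gball E i {r} \<inter> core R E)}"
  let ?x = "exp (- (c * (1 - eta - \<tau>)))"
  \<comment> \<open>An upper bound for minus the logarithm of the factor belonging to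
    \<open>r\<close>, so that the product becomes a sum.\<close>
  define g where "g r = (if r \<in> heavy R E then 1 else 0) + (1 + \<kappa>) * ((if r \<in> ?H then exp (- (c / 4)) else 0) + ?x)" for r
  have x0: "0 \<le> (1 + \<kappa>) * exp (- (c / 4))" "0 \<le> (1 + \<kappa>) * ?x"
    using \<kappa> by simp_all
  have factor: "exp (- g r) \<le> 1 - (1 - p) ^ card (target m R E r)" if r: "r \<in> R" for r
  proof -
    have rV: "{r} \<subseteq> {1..n}" using r R(1) by blast
    let ?B = "gball E i {r}"
    have finB: "finite ?B" using rV by (rule finite_gball)
    show ?thesis
    proof (cases "r \<in> heavy R E")
      case True
      have "card (nbhd E ?B) \<le> card (target m R E r) + card (core R E) + card (chosen m R E)"
      proof -
        have "nbhd E ?B \<subseteq> {1..n}"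
          using gball_V[OF rV, of "Suc i"] by simp
        then have "nbhd E ?B \<subseteq> target m R E r \<union> core R E \<union> chosen m R E"
          using True by (auto simp: target_def rest_def)
        moreover have "finite (target m R E r \<union> core R E \<union> chosen m R E)"
          using target_subset[OF R(1) Et(1) r] core_subset[OF R(1) Et(1)] chosen_subset[of m R E]
          by (auto simp: rest_def intro: finite_subset)
        ultimately have "card (nbhd E ?B) \<le> card (target m R E r \<union> core R E \<union> chosen m R E)"
          by (intro card_mono)
        also have "\<dots> \<le> card (target m R E r) + card (core R E) + card (chosen m R E)"
          using card_Un_le[of "target m R E r \<union> core R E" "chosen m R E"] card_Un_le[of "target m R E r" "core R E"]
          by linarith
        finally show ?thesis .
      qed
      moreover have "n / 20 \<le> card (nbhd E ?B)"
        using rV by (intro card_nbhd_gball_ge) simp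
      moreover have "card (chosen m R E) \<le> n / 100"
        using chosen(2)[OF far] m_le' by simp
      moreover have "card (core R E) \<le> n / 100"
        using card_core_le[OF Et R] core_bound_le'' by linarith
      \<comment> \<open>The neighbourhood has at least n/20 elements, of which the core and the
        chosen vertices take at most n/100 each.\<close>
      ultimately have "n / 40 \<le> card (target m R E r)"
        by linarith
      then have "p * (n / 40) \<le> p * card (target m R E r)"
        using p by (intro mult_left_mono) auto
      moreover have "1 \<le> p * (n / 40)"
        using d40 p by (simp add: d_def algebra_simps)
      ultimately have "1 \<le> p * card (target m R E r)" by linarith
      have "(1 - p) ^ card (target m R E r) \<le> exp (- (p * card (target m R E r)))"
        using p by (intro power_one_minus_le_exp) simp
      also have "\<dots> \<le> exp (- 1)" using \<open>1 \<le> p * card (target m R E r)\<close> by simp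
      also have "\<dots> \<le> 1 / 2"
        using exp_ge_add_one_self[of 1] by (simp add: exp_minus field_simps)
      finally have "1 / 2 \<le> 1 - (1 - p) ^ card (target m R E r)" by simp
      moreover have "exp (- g r) \<le> exp (- 1)"
        using True x0 by (simp add: g_def distrib_left)
      moreover have "exp (- 1) \<le> (1 / 2 :: real)"
        using exp_ge_add_one_self[of 1] by (simp add: exp_minus field_simps)
      ultimately show ?thesis by linarith
    next
      case False
      let ?t = "card (target m R E r)"
      define x where "x = (1 - p) ^ ?t"
      have x_exp: "x \<le> exp (- (p * ?t))"
        unfolding x_def using p by (intro power_one_minus_le_exp) simp
      have "?t + card (?B \<inter> core R E) = card ?B"
        using False finB by (metis card_Diff_subset_Int card_mono finite_Int inf_le1 le_add_diff_inverse2 target_def)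
      moreover have "d ^ i * (1 - eta) \<le> card ?B"
        using card_gball_ge[OF rV] K1 by simp
      ultimately have t: "d ^ i * (1 - eta) - card (?B \<inter> core R E) \<le> ?t" by linarith
      have c_le: "x \<le> exp (- (c * w))" if "d ^ i * w \<le> ?t" "0 \<le> w" for w
      proof -
        have "c * w \<le> p * d ^ i * w" using p_d_pow that(2) by (rule mult_right_mono)
        also have "\<dots> \<le> p * ?t"
          using that(1) p mult_left_mono[of "d ^ i * w" "real ?t" p] by (simp add: mult.assoc)
        finally show ?thesis using x_exp by (meson exp_le_cancel_iff neg_le_iff_le order_trans)
      qed
      have "card (?B \<inter> core R E) \<le> d ^ i / 2"
        using False r by (auto simp: heavy_def)
      moreover have "d ^ i * (1 / 4) \<le> d ^ i * (1 / 2 - eta)"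
        using eta d1 by (intro mult_left_mono) auto
      ultimately have "d ^ i * (1 / 4) \<le> ?t"
        using t by (simp add: algebra_simps)
      then have x4: "x \<le> exp (- (c / 4))"
        using c_le[of "1 / 4"] by simp
      \<comment> \<open>If the exponent has the wrong sign, the right-hand side is at least 1 and
        the bound is trivial.\<close>
      have x_tau: "x \<le> ?x" if "r \<notin> ?H"
      proof (cases "0 \<le> 1 - eta - \<tau>")
        case True
        have "card (?B \<inter> core R E) \<le> \<tau> * d ^ i"
          using that r by auto
        then have "d ^ i * (1 - eta - \<tau>) \<le> ?t"
          using t by (simp add: algebra_simps)
        then show ?thesis using True by (rule c_le)
      next
        case False
        then have "0 \<le> - (c * (1 - eta - \<tau>))"
          using c1 by (simp add: mult_nonneg_nonpos)
        then have "1 \<le> ?x" by simp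
        moreover have "x \<le> 1" unfolding x_def using p by (intro power_le_one) auto
        ultimately show ?thesis by linarith
      qed
      \<comment> \<open>The aim is 2 x \<le> \<kappa>, which makes the quadratic term of ln(1 - x) a
        relative error of at most \<kappa>.\<close>
      have "\<kappa>\<^sup>2 / 4 \<le> \<kappa> / 2"
        using \<kappa> mult_left_mono[of \<kappa> 1 \<kappa>] by (simp add: power2_eq_square)
      then have xk: "2 * x \<le> \<kappa>"
        using x4 c_large(1) by linarith
      have xn: "0 \<le> x" unfolding x_def using p by simp
      have "x \<le> (if r \<in> ?H then exp (- (c / 4)) else 0) + ?x"
        using x4 x_tau by (cases "r \<in> ?H") (simp_all add: add_increasing2)
      then have "(1 + \<kappa>) * x \<le> g r"
        using False \<kappa> by (simp add: g_def)
      moreover have "x + 2 * x\<^sup>2 \<le> (1 + \<kappa>) * x"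
        using mult_right_mono[OF xk xn] by (simp add: power2_eq_square algebra_simps)
      ultimately have "exp (- g r) \<le> exp (- x - 2 * x\<^sup>2)" by simp
      also have "\<dots> \<le> 1 - x"
        using xn xk \<kappa> by (intro exp_neg_le_one_minus) auto
      finally show ?thesis by (simp add: x_def)
    qed
  qed
  have sum: "(\<Sum>r\<in>R. g r) \<le> 5 * \<kappa> * L + (1 + 4 * \<kappa>) * (s * exp (- c))"
  proof -
    have hsub: "{r \<in> R. r \<in> heavy R E} = heavy R E" by (auto simp: heavy_def)
    have "(\<Sum>r\<in>R. g r) = card (heavy R E) + (1 + \<kappa>) * (card ?H * exp (- (c / 4)) + s * ?x)"
      unfolding g_def using finR hsub R(2)
      by (simp add: sum.distrib sum_distrib_left[symmetric] sum.If_cases Int_absorb1 Int_def)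
    moreover have "card (heavy R E) \<le> \<kappa> * L"
      by (rule card_heavy_le'[OF Et R])
    moreover have "(1 + \<kappa>) * (card ?H * exp (- (c / 4)) + s * ?x)
        \<le> (1 + \<kappa>) * (\<kappa> * L + ((1 + 2 * \<kappa>) * (s * exp (- c)) + \<kappa> * L))"
    proof (intro mult_left_mono add_mono)
      have "real (card ?H) \<le> 4 * L / (c * \<tau>)"
        by (rule card_heavy_tau[OF Et R \<tau>(1,2)])
      also have "\<dots> \<le> 4 * L / \<kappa>"
        using \<tau>(2) \<kappa> L1 by (intro divide_left_mono) auto
      finally have "card ?H * exp (- (c / 4)) \<le> 4 * L / \<kappa> * (\<kappa>\<^sup>2 / 4)"
        using c_large(1) \<kappa> L1 by (intro mult_mono) auto
      then show "card ?H * exp (- (c / 4)) \<le> \<kappa> * L"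
        using \<kappa> by (simp add: power2_eq_square mult.commute)
      have "s * ?x \<le> s * ((1 + 2 * \<kappa>) * exp (- c) + \<kappa> * c / d)"
        using \<tau>(3) by (intro mult_left_mono) auto
      also have "\<dots> = (1 + 2 * \<kappa>) * (s * exp (- c)) + \<kappa> * (s * c / d)"
        by (simp add: algebra_simps)
      also have "s * c / d \<le> L"
        using s_le c1 d1 by (simp add: field_simps)
      finally show "s * ?x \<le> (1 + 2 * \<kappa>) * (s * exp (- c)) + \<kappa> * L"
        using \<kappa> by simp
    qed (use \<kappa> in simp)
    moreover have "(1 + \<kappa>) * (1 + 2 * \<kappa>) \<le> 1 + 4 * \<kappa>"
      using \<kappa> mult_left_mono[of \<kappa> "1 / 4" \<kappa>] by (simp add: algebra_simps)
    then have "(1 + \<kappa>) * (1 + 2 * \<kappa>) * (s * exp (- c)) \<le> (1 + 4 * \<kappa>) * (s * exp (- c))"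
      by (intro mult_right_mono) auto
    moreover have "(1 + \<kappa>) * (2 * (\<kappa> * L)) \<le> 2 * (2 * (\<kappa> * L))"
      using \<kappa> L1 by (intro mult_right_mono) auto
    ultimately show ?thesis by (simp add: algebra_simps)
  qed
  have "exp (- (5 * \<kappa> * L) - (1 + 4 * \<kappa>) * (s * exp (- c))) \<le> exp (- (\<Sum>r\<in>R. g r))"
    using sum by simp
  also have "\<dots> = (\<Prod>r\<in>R. exp (- g r))"
    using finR by (simp add: exp_sum flip: sum_negf)
  also have "\<dots> \<le> (\<Prod>r\<in>R. 1 - (1 - p) ^ card (target m R E r))"
    using factor by (intro prod_mono) auto
  finally show ?thesis .
qed

text \<open>In a typical graph the core obeys \<open>core_bound\<close>, so either there are at most
  \<open>m\<close> far vertices, handled by \<open>far_tail\<close>, or there are enough of them and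
  \<open>resolving_tail\<close> applies with \<open>M\<close> = exp(\<kappa> L).\<close>

lemma prob_typical_resolving:
  assumes R: "R \<subseteq> {1..n}" "card R = s"
  shows "bexp p (vertex_pairs {1..n}) (\<lambda>E. of_bool (typical {1..n} d lam E \<and> resolving {1..n} E R))
    \<le> 2 * exp (- (exp (G * L) / 800))"
proof -
  let ?I = "vertex_pairs {1..n}" and ?Q = "exp (- ((1 + \<kappa>) * s * (d ^ i / n)))"
  let ?q = "exp (- (5 * \<kappa> * L) - (1 + 4 * \<kappa>) * (s * exp (- c)))"
  have q1: "?q \<le> 1"
  proof -
    have "0 \<le> 5 * \<kappa> * L" "0 \<le> (1 + 4 * \<kappa>) * (s * exp (- c))" using \<kappa> L1 by simp_all
    then have "- (5 * \<kappa> * L) - (1 + 4 * \<kappa>) * (s * exp (- c)) \<le> 0" by linarith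
    then show ?thesis by (simp only: exp_le_one_iff)
  qed
  have nQ: "exp (G * L) \<le> n * ?Q"
    using exp_GL_le mult_left_mono[OF q1, of "n * ?Q"] by simp
  have "bexp p ?I (\<lambda>E. of_bool (typical {1..n} d lam E \<and> resolving {1..n} E R))
    \<le> bexp p ?I (\<lambda>E. of_bool (card (core R E) \<le> core_bound \<and> real (card (far R E)) \<le> m) +
        of_bool (typical {1..n} d lam E \<and> m \<le> card (far R E) \<and> resolving {1..n} E R))"
    using card_core_le[OF _ _ R] by (intro bexp_mono p01) (auto simp: of_bool_def)
  also have "\<dots> = bexp p ?I (\<lambda>E. of_bool (card (core R E) \<le> core_bound \<and> real (card (far R E)) \<le> m)) +
      bexp p ?I (\<lambda>E. of_bool (typical {1..n} d lam E \<and> m \<le> card (far R E) \<and> resolving {1..n} E R))"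
    by (rule bexp_add)
  also have "\<dots> \<le> exp (m - (real n - real core_bound) * (1 - p) ^ core_bound / 2) + exp (exp (\<kappa> * L) - m * ?q / 2)"
  proof (intro add_mono far_tail resolving_tail R(1))
    fix E assume E: "E \<subseteq> ?I" "typical {1..n} d lam E" "m \<le> card (far R E)"
    have "(2 :: real) ^ card (heavy R E) \<le> exp 1 ^ card (heavy R E)"
      using exp_ge_add_one_self[of 1] by (intro power_mono) auto
    also have "\<dots> = exp (card (heavy R E))" by (simp flip: exp_of_nat_mult)
    also have "\<dots> \<le> exp (\<kappa> * L)" using card_heavy_le'[OF E(1,2) R] by simp
    finally show "2 ^ card (heavy R E) \<le> exp (\<kappa> * L) \<and>
        ?q \<le> (\<Prod>r\<in>R. 1 - (1 - p) ^ card (target m R E r))"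
      using target_prod_ge[OF E(1,2) R E(3)] by simp
  qed simp
  also have "\<dots> \<le> exp (- (exp (G * L) / 800)) + exp (- (exp (G * L) / 800))"
  proof (intro add_mono)
    have "n / 2 * ?Q \<le> (real n - real core_bound) * (1 - p) ^ core_bound"
      using core_bound_le'' avoid_core_ge by (intro mult_mono) auto
    then have "m - (real n - real core_bound) * (1 - p) ^ core_bound / 2 \<le> - (exp (G * L) / 800)"
      using m_le nQ by simp
    then show "exp (m - (real n - real core_bound) * (1 - p) ^ core_bound / 2) \<le> exp (- (exp (G * L) / 800))"
      by simp
    have "1 * 800 \<le> exp (\<kappa> * L) * 800" using \<kappa> L1 by (intro mult_right_mono) auto
    \<comment> \<open>Ensures that the floor in the definition of \<open>m\<close> loses at most
      half of n Q / 100.\<close>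
    then have "200 \<le> n * ?Q"
      using G_large(1) nQ by linarith
    then have "n * ?Q / 200 \<le> m"
      unfolding m by linarith
    then have "n * ?Q / 200 * ?q \<le> m * ?q"
      by (rule mult_right_mono) simp
    moreover have "n * ?Q / 200 * ?q = n * ?Q * ?q / 200"
      by (simp only: times_divide_eq_left)
    ultimately have "exp (G * L) / 200 \<le> m * ?q"
      using exp_GL_le by linarith
    then have "exp (\<kappa> * L) - m * ?q / 2 \<le> - (exp (G * L) / 800)"
      using G_large(1) by simp
    then show "exp (exp (\<kappa> * L) - m * ?q / 2) \<le> exp (- (exp (G * L) / 800))"
      by simp
  qed
  finally show ?thesis by simp
qed

text \<open>A union bound over at most n^s = exp(s L) sets. The doubly exponential estimate wins
  because s L + L \<le> n^G / 800.\<close>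

lemma prob_resolving:
  "bexp p (vertex_pairs {1..n}) (\<lambda>E. of_bool (\<exists>R\<subseteq>{1..n}. card R = s \<and> resolving {1..n} E R)) \<le> 6 / n"
proof -
  let ?I = "vertex_pairs {1..n}" and ?S = "{R. R \<subseteq> {1..n} \<and> card R = s}"
  let ?T = "typical {1..n} d lam"
  have finS: "finite ?S" by simp
  have "bexp p ?I (\<lambda>E. of_bool (\<exists>R\<subseteq>{1..n}. card R = s \<and> resolving {1..n} E R))
    \<le> bexp p ?I (\<lambda>E. of_bool (\<not> ?T E) + (\<Sum>R\<in>?S. of_bool (?T E \<and> resolving {1..n} E R)))"
  proof (intro bexp_mono p01)
    fix E :: "nat set set"
    have nn: "0 \<le> (\<Sum>R\<in>?S. of_bool (?T E \<and> resolving {1..n} E R) :: real)"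
      by (intro sum_nonneg) simp
    show "of_bool (\<exists>R\<subseteq>{1..n}. card R = s \<and> resolving {1..n} E R)
      \<le> of_bool (\<not> ?T E) + (\<Sum>R\<in>?S. of_bool (?T E \<and> resolving {1..n} E R) :: real)"
    proof (cases "?T E \<and> (\<exists>R\<subseteq>{1..n}. card R = s \<and> resolving {1..n} E R)")
      case True
      then obtain R where "R \<in> ?S" "?T E \<and> resolving {1..n} E R" by blast
      then have "1 \<le> (\<Sum>R\<in>?S. of_bool (?T E \<and> resolving {1..n} E R) :: real)"
        using member_le_sum[of R ?S "\<lambda>R. of_bool (?T E \<and> resolving {1..n} E R) :: real"] finS by simp
      moreover have "of_bool (\<exists>R\<subseteq>{1..n}. card R = s \<and> resolving {1..n} E R) \<le> (1 :: real)" "0 \<le> (of_bool (\<not> ?T E) :: real)"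
        by simp_all
      ultimately show ?thesis by linarith
    next
      case False
      then have "of_bool (\<exists>R\<subseteq>{1..n}. card R = s \<and> resolving {1..n} E R) \<le> (of_bool (\<not> ?T E) :: real)"
        by (auto simp: of_bool_def)
      then show ?thesis using nn by linarith
    qed
  qed
  also have "\<dots> = bexp p ?I (\<lambda>E. of_bool (\<not> ?T E)) + (\<Sum>R\<in>?S. bexp p ?I (\<lambda>E. of_bool (?T E \<and> resolving {1..n} E R)))"
    by (simp only: bexp_add bexp_sum)
  also have "\<dots> \<le> 4 / n + (\<Sum>R\<in>?S. 2 * exp (- (exp (G * L) / 800)))"
    using prob_not_typical prob_typical_resolving by (intro add_mono sum_mono) auto
  also have "(\<Sum>R\<in>?S. 2 * exp (- (exp (G * L) / 800))) \<le> 2 / n"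
  proof -
    have "card ?S = n choose s" using n_subsets[of "{1..n}" s] by simp
    also have "n choose s \<le> n ^ s"
    proof (cases "s \<le> n")
      case True
      then show ?thesis by (rule binomial_le_pow)
    qed (simp add: binomial_eq_0)
    finally have "real (card ?S) \<le> real (n ^ s)" by (rule of_nat_mono)
    also have "\<dots> = exp (s * L)"
      using n by (simp add: L_def exp_of_nat_mult)
    finally have "(\<Sum>R\<in>?S. 2 * exp (- (exp (G * L) / 800))) \<le> exp (s * L) * (2 * exp (- (exp (G * L) / 800)))"
      by (simp add: mult_right_mono)
    also have "\<dots> = 2 * exp (s * L - exp (G * L) / 800)"
      using exp_add[of "s * L" "- (exp (G * L) / 800)"] by simp
    also have "\<dots> \<le> 2 * exp (- L)"
    proof -
      have "1600 * (s * L) + 1600 * L \<le> 2 * exp (G * L)"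
        using sL_le G_large(3) by linarith
      then have "s * L - exp (G * L) / 800 \<le> - L" by linarith
      then show ?thesis by simp
    qed
    also have "\<dots> = 2 / n"
      using n by (simp add: L_def exp_minus divide_inverse)
    finally show ?thesis .
  qed
  finally show ?thesis by simp
qed

end

section \<open>Asymptotics\<close>

lemma resolving_superset:
  assumes "resolving V E R" "R \<subseteq> R'" "R' \<subseteq> V"
  shows "resolving V E R'"
proof -
  have "dist_vector E R v = dist_vector E R w" if "dist_vector E R' v = dist_vector E R' w" for v w
    unfolding dist_vector_def
  proof (rule restrict_ext)
    fix r assume "r \<in> R"
    then have "r \<in> R'" using assms(2) by blast
    then show "graph_dist E v r = graph_dist E w r"
      using fun_cong[OF that, of r] by (simp add: dist_vector_def)
  qed
  then show ?thesis
    using assms unfolding resolving_def by blast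
qed

lemma resolving_self: "resolving V E V"
  unfolding resolving_def
proof (intro conjI ballI impI notI subset_refl)
  fix v w assume *: "v \<in> V" "w \<in> V" "v \<noteq> w" "dist_vector E V v = dist_vector E V w"
  have "graph_dist E v v \<le> enat 0" "\<not> graph_dist E w v \<le> enat 0"
    using *(3) by (simp_all only: graph_dist_le_iff) auto
  moreover have "graph_dist E v v = graph_dist E w v"
    using fun_cong[OF *(4), of v] *(1) by (simp add: dist_vector_def)
  ultimately show False by simp
qed

text \<open>A minimum resolving set is enlarged to exactly \<open>s\<close> elements; the minimum
  exists because the whole vertex set is resolving. Thus a union bound over sets of a single size
  suffices.\<close>

lemma ex_resolving_of_card:
  assumes "finite V" "metric_dimension V E \<le> s" "s \<le> card V"
  shows "\<exists>R\<subseteq>V. card R = s \<and> resolving V E R"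
proof -
  have "finite {R. resolving V E R}"
    using assms(1) by (rule finite_subset[rotated, OF finite_Pow_iff[THEN iffD2]]) (auto simp: resolving_def)
  then have "metric_dimension V E \<in> card ` {R. resolving V E R}"
    unfolding metric_dimension_def using resolving_self[of V E] by (intro Min_in) auto
  then obtain R where R: "resolving V E R" "card R = metric_dimension V E"
    by auto
  then have RV: "R \<subseteq> V" by (simp add: resolving_def)
  have "\<exists>R'. R \<subseteq> R' \<and> R' \<subseteq> V \<and> card R' = s"
    using assms RV R(2) by (intro exists_subset_between) auto
  then show ?thesis using resolving_superset[OF R(1)] by blast
qed

text \<open>The theorem for one \<open>n\<close>, with every asymptotic assumption replaced by an
  explicit inequality. The choice \<epsilon> = 40 \<kappa> leaves 31 \<kappa> in the exponent
  \<open>G\<close> beyond 1 / (i + 1). With \<open>s\<close> the floor of the claimed bound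
  \<open>X\<close>, a metric dimension below \<open>X\<close> would yield a resolving set of size
  exactly \<open>s\<close>.\<close>

lemma metric_dimension_lower_bound:
  fixes n i :: nat and p d c L \<kappa> \<epsilon> :: real
  assumes \<epsilon>: "\<epsilon> = 40 * \<kappa>" "0 < \<epsilon>" "\<epsilon> \<le> 1 / 2"
    and p_ge: "0 \<le> p" and d_def: "d = p * (real n - 1)" and c_def: "c = d ^ (i + 1) / n" and L_def: "L = ln n"
    and n_large: "16 / \<kappa> + 2 \<le> n" and L1: "L \<ge> 1" and i_ge: "i \<ge> 1"
    and dL: "(512 / \<kappa>)\<^sup>2 * L ^ 3 \<le> d" and dn: "d \<le> \<kappa> / 32 * n" and d_pow: "d ^ i \<le> n" and d_kap: "(1 / \<kappa>) ^ 3 \<le> d"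
    and cL: "c \<le> 3 * L" and c_large: "exp (- (c / 4)) \<le> \<kappa>\<^sup>2 / 4" "8 / \<kappa> \<le> c"
    and L_large: "800 \<le> exp (30 * \<kappa> * L)" "1600 * L\<^sup>2 \<le> exp (31 * \<kappa> * L)"
  shows "1 - 6 / n \<le> measure_pmf.prob (random_graph n p)
     {E. real (metric_dimension {1..n} E) \<ge>
        (real i / real (i + 1) - \<epsilon>) * inverse (d ^ i / n + exp (- c)) * L}"
proof -
  have kap: "0 < \<kappa>" "\<kappa> \<le> 1 / 80" using \<epsilon> by simp_all
  have n2: "2 \<le> n" using n_large kap divide_nonneg_pos[of 16 \<kappa>] by linarith
  have c1: "1 \<le> c"
  proof -
    have "1 \<le> 8 / \<kappa>" using kap by simp
    then show ?thesis using c_large(2) by linarith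
  qed
  have big: "(512 / \<kappa>)\<^sup>2 = 262144 / \<kappa>\<^sup>2" by (simp add: power_divide)
  have dL3: "262144 * L ^ 3 \<le> \<kappa>\<^sup>2 * d"
    using dL kap unfolding big by (simp add: field_simps)
  have L3: "L \<le> L ^ 3" "L\<^sup>2 \<le> L ^ 3" "1 \<le> L ^ 3"
    using L1 power_increasing[of 1 3 L] power_increasing[of 2 3 L] one_le_power[of L 3] by simp_all
  have d_pos: "0 < d"
  proof -
    have "0 < (1 / \<kappa>) ^ 3" using kap by simp
    then show ?thesis using d_kap by linarith
  qed
  have kd: "\<kappa>\<^sup>2 * d \<le> \<kappa> / 80 * d" "\<kappa>\<^sup>2 * d \<le> 1 * d"
  proof -
    have "\<kappa> * \<kappa> \<le> \<kappa> * (1 / 80)" using kap by (intro mult_left_mono) auto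
    then have "\<kappa>\<^sup>2 \<le> \<kappa> / 80" by (simp add: power2_eq_square)
    then show "\<kappa>\<^sup>2 * d \<le> \<kappa> / 80 * d" "\<kappa>\<^sup>2 * d \<le> 1 * d"
      using kap d_pos by (auto intro!: mult_right_mono)
  qed
  have dL': "262144 * L ^ 3 \<le> d" using dL3 kd by linarith
  define lam where "lam = 4 * sqrt (L / d)"
  define K where "K = 5 * L / \<kappa>"
  define mu where "mu = lam + 6 * K * c / d"
  define eta where "eta = 2 * i * mu"
  have lam0: "0 \<le> lam" using L1 d_pos by (simp add: lam_def)
  \<comment> \<open>This is where the cube of the logarithm enters: L lam = 4 sqrt(L^3 / d). The
    extra factor \<open>L\<close> is needed because \<open>i\<close> can grow, and only i ln d \<le>
    L is known about it.\<close>
  have Llam: "L * lam \<le> \<kappa> / 128"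
  proof -
    have "sqrt (L ^ 3 / d) \<le> \<kappa> / 512"
    proof (rule real_le_lsqrt)
      show "L ^ 3 / d \<le> (\<kappa> / 512)\<^sup>2"
        using dL3 d_pos by (simp add: power_divide field_simps)
    qed (use kap in simp)
    moreover have "L * sqrt (L / d) = sqrt (L ^ 3 / d)"
    proof -
      have "sqrt (L ^ 3 / d) = sqrt (L\<^sup>2 * (L / d))" by (simp add: power3_eq_cube power2_eq_square)
      then show ?thesis using L1 by (simp only: real_sqrt_mult) simp
    qed
    ultimately show ?thesis by (simp add: lam_def)
  qed
  have Kc: "K * c \<le> 15 * L\<^sup>2 / \<kappa>"
  proof -
    have "K * c \<le> K * (3 * L)" using cL kap L1 by (intro mult_left_mono) (auto simp: K_def)
    then show ?thesis by (simp add: K_def power2_eq_square)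
  qed
  have K0: "0 \<le> K * c" using kap L1 c1 by (simp add: K_def)
  have LKc: "L * (6 * K * c / d) \<le> \<kappa> / 128"
  proof -
    have "L * (K * c) \<le> L * (15 * L\<^sup>2 / \<kappa>)" using Kc L1 by (intro mult_left_mono) auto
    also have "\<dots> = 15 * L ^ 3 / \<kappa>" by (simp add: power3_eq_cube power2_eq_square)
    also have "\<dots> \<le> \<kappa> * d / 768"
    proof -
      have "15 * L ^ 3 \<le> \<kappa>\<^sup>2 * d / 768" using dL3 L3(3) by linarith
      then show ?thesis using kap by (simp add: field_simps power2_eq_square)
    qed
    finally show ?thesis using d_pos by (simp add: field_simps)
  qed
  have mu0: "0 \<le> mu" using lam0 K0 d_pos by (simp add: mu_def)
  have Lmu: "L * mu \<le> \<kappa> / 64"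
    using Llam LKc by (simp add: mu_def distrib_left)
  have lnd: "1 \<le> ln d"
  proof -
    have "exp 1 \<le> d" using exp_le dL' L3 L1 by linarith
    then have "ln (exp 1) \<le> ln d" by (subst ln_le_cancel_iff) (use d_pos in auto)
    then show ?thesis by simp
  qed
  have iL: "i * ln d \<le> L"
  proof -
    have "ln (d ^ i) \<le> ln n" using d_pow d_pos n2 by (subst ln_le_cancel_iff) auto
    then show ?thesis using d_pos by (simp add: L_def ln_realpow)
  qed
  have iL': "i \<le> L"
  proof -
    have "real i * 1 \<le> i * ln d" using lnd by (intro mult_left_mono) auto
    then show ?thesis using iL by simp
  qed
  have eta_le: "eta \<le> \<kappa> / 32"
  proof -
    have "i * mu \<le> L * mu" using iL' mu0 by (intro mult_right_mono) auto
    then show ?thesis using Lmu by (simp add: eta_def)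
  qed
  have eta0: "0 \<le> eta" using mu0 by (simp add: eta_def)
  have d_ge: "200 * L \<le> d" "40 \<le> d" "1 \<le> d"
    using dL' L3 L1 by linarith+
  have p_eq: "p \<le> \<kappa> / 16"
  proof -
    have "p * (real n - 1) \<le> \<kappa> / 32 * n" using dn by (simp add: d_def)
    also have "\<dots> \<le> \<kappa> / 32 * (2 * (real n - 1))" using kap n2 by (intro mult_left_mono) auto
    finally have "p * (real n - 1) \<le> \<kappa> / 16 * (real n - 1)" by (simp add: algebra_simps)
    then show ?thesis using n2 by (simp add: mult_le_cancel_right)
  qed
  interpret graph_params n i p d c L \<kappa> lam K mu eta
  proof
    show "4 * d \<le> n"
    proof -
      have "\<kappa> / 32 * n \<le> 1 / 4 * n" using kap by (intro mult_right_mono) auto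
      then show ?thesis using dn by simp
    qed
    show "lam \<le> 1 / 10"
      using Llam kap mult_right_mono[OF L1 lam0] by simp
    show "8 * K * c \<le> d"
    proof -
      have "1 * (6 * K * c / d) \<le> L * (6 * K * c / d)"
        using L1 K0 d_pos by (intro mult_right_mono) auto
      then have "6 * K * c / d \<le> \<kappa> / 128" using LKc by linarith
      then have "6 * K * c / d \<le> 1 / 2" using kap by linarith
      then show ?thesis using d_pos by (simp add: field_simps)
    qed
  qed (use n2 i_ge p_ge p_eq d_def c_def L_def lam_def K_def mu_def eta_def kap d_ge c1 L1 eta_le in auto)
  define X where "X = (real i / real (i + 1) - \<epsilon>) * inverse (d ^ i / n + exp (- c)) * L"
  define s where "s = nat \<lfloor>X\<rfloor>"
  define m where "m = nat \<lfloor>n * exp (- ((1 + \<kappa>) * s * (d ^ i / n))) / 100\<rfloor>"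
  define G where "G = 1 / real (i + 1) + \<epsilon> - 9 * \<kappa>"
  \<comment> \<open>The errors \<open>eta\<close> and \<tau> in the ball sizes are multiplied by
    \<open>c\<close> in the exponent. For c \<le> 2 ln d this stays below 5/4 \<kappa>, because (i
    ln d) mu \<le> L mu. For larger \<open>c\<close> a constant loss is harmless: exp(-11 c / 16) is
    then at most d^(-4/3), hence below \<kappa> / d.\<close>
  define \<tau> where "\<tau> = (if c \<le> 2 * ln d then \<kappa> / c else 1 / 4)"
  have a0: "0 < d ^ i / n + exp (- c)"
    using d_pos by (intro add_nonneg_pos) auto
  have \<alpha>: "\<epsilon> \<le> real i / real (i + 1)"
  proof -
    have "1 / 2 \<le> real i / real (i + 1)" using i_ge by (simp add: field_simps)
    then show ?thesis using \<epsilon>(3) by linarith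
  qed
  have X0: "0 \<le> X"
    unfolding X_def using a0 \<alpha> L1 by (intro mult_nonneg_nonneg) auto
  have sX: "s \<le> X" unfolding s_def using X0 by (rule of_nat_floor)
  have \<tau>_props: "4 * eta \<le> \<tau>" "\<kappa> \<le> c * \<tau>"
    "exp (- (c * (1 - eta - \<tau>))) \<le> (1 + 2 * \<kappa>) * exp (- c) + \<kappa> * c / d"
  proof -
    have "4 * eta \<le> \<tau> \<and> \<kappa> \<le> c * \<tau> \<and>
      exp (- (c * (1 - eta - \<tau>))) \<le> (1 + 2 * \<kappa>) * exp (- c) + \<kappa> * c / d"
    proof (cases "c \<le> 2 * ln d")
      case True
      then have \<tau>: "\<tau> = \<kappa> / c" by (simp add: \<tau>_def)
      have ceta: "c * eta \<le> \<kappa> / 4"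
      proof -
        have "c * eta \<le> 2 * ln d * eta" using True eta0 by (intro mult_right_mono) auto
        also have "\<dots> = 4 * ((i * ln d) * mu)" by (simp add: eta_def)
        also have "\<dots> \<le> 4 * (L * mu)" using iL mu0 by (intro mult_left_mono mult_right_mono) auto
        finally show ?thesis using Lmu kap by linarith
      qed
      have "4 * eta \<le> \<tau>"
        using ceta c1 unfolding \<tau> by (simp add: field_simps)
      moreover have "\<kappa> \<le> c * \<tau>" using c1 by (simp add: \<tau>)
      moreover have "exp (- (c * (1 - eta - \<tau>))) \<le> (1 + 2 * \<kappa>) * exp (- c)"
      proof -
        have "- (c * (1 - eta - \<tau>)) = c * eta + \<kappa> + - c"
          using c1 by (simp add: \<tau> algebra_simps)
        then have "exp (- (c * (1 - eta - \<tau>))) \<le> exp (5 / 4 * \<kappa> + - c)"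
          using ceta by simp
        also have "\<dots> = exp (5 / 4 * \<kappa>) * exp (- c)" by (rule exp_add)
        also have "exp (5 / 4 * \<kappa>) \<le> 1 + 5 / 4 * \<kappa> + (5 / 4 * \<kappa>)\<^sup>2"
          using kap by (intro exp_bound) auto
        also have "\<dots> \<le> 1 + 2 * \<kappa>"
        proof -
          have "\<kappa> * \<kappa> \<le> \<kappa> * (1 / 80)" using kap by (intro mult_left_mono) auto
          moreover have "(5 / 4 * \<kappa>)\<^sup>2 = 25 / 16 * (\<kappa> * \<kappa>)" by (simp add: power2_eq_square)
          ultimately show ?thesis using kap by linarith
        qed
        finally show ?thesis by simp
      qed
      moreover have "0 \<le> \<kappa> * c / d" using kap c1 d_pos by simp
      ultimately show ?thesis by linarith
    next
      case False
      then have \<tau>: "\<tau> = 1 / 4" by (simp add: \<tau>_def)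
      have "8 \<le> c * \<kappa>" using c_large(2) kap by (simp add: field_simps)
      then have "\<kappa> \<le> c * \<tau>" using kap c1 unfolding \<tau> by linarith
      moreover have "4 * eta \<le> \<tau>" using eta_le kap unfolding \<tau> by linarith
      moreover have "exp (- (c * (1 - eta - \<tau>))) \<le> \<kappa> * c / d"
      proof -
        have "c * (11 / 16) \<le> c * (1 - eta - \<tau>)"
          using eta_le kap c1 unfolding \<tau> by (intro mult_left_mono) auto
        moreover have "ln d + 1 / 3 * ln d \<le> c * (11 / 16)" using False lnd by linarith
        moreover have "ln (1 / \<kappa>) \<le> 1 / 3 * ln d"
        proof -
          have "ln ((1 / \<kappa>) ^ 3) \<le> ln d"
            using d_kap kap d_pos by (subst ln_le_cancel_iff) auto
          moreover have "ln ((1 / \<kappa>) ^ 3) = 3 * ln (1 / \<kappa>)"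
            using kap by (subst ln_realpow) auto
          ultimately show ?thesis by linarith
        qed
        ultimately have "exp (- (c * (1 - eta - \<tau>))) \<le> exp (- ln d + - ln (1 / \<kappa>))"
          by simp
        also have "\<dots> = \<kappa> / d"
          unfolding exp_add using kap d_pos by (simp add: exp_minus ln_div field_simps)
        also have "\<dots> \<le> \<kappa> * c / d"
          using kap c1 d_pos by (intro divide_right_mono) auto
        finally show ?thesis .
      qed
      moreover have "0 \<le> (1 + 2 * \<kappa>) * exp (- c)" using kap by simp
      ultimately show ?thesis by linarith
    qed
    then show "4 * eta \<le> \<tau>" "\<kappa> \<le> c * \<tau>"
      "exp (- (c * (1 - eta - \<tau>))) \<le> (1 + 2 * \<kappa>) * exp (- c) + \<kappa> * c / d" by blast+
  qed
  have expG: "exp (G * L) = exp (L / real (i + 1)) * exp (31 * \<kappa> * L)"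
    unfolding G_def \<epsilon>(1) by (simp add: algebra_simps flip: exp_add)
  have exp_ge1: "1 \<le> exp (L / real (i + 1))" using L1 by simp
  interpret landmark_params n i p d c L \<kappa> lam K mu eta s m \<tau> \<epsilon> G
  proof
    have "s * (d ^ i / n + exp (- c)) \<le> X * (d ^ i / n + exp (- c))"
      using sX a0 by (intro mult_right_mono) auto
    also have "\<dots> = (real i / real (i + 1) - \<epsilon>) * L"
      using a0 by (simp add: X_def)
    finally show "s * (d ^ i / n + exp (- c)) \<le> (real i / real (i + 1) - \<epsilon>) * L" .
    show "(1 + 2 * p) * (1 + eta) * n \<le> (1 + \<kappa>) * (real n - 1)"
    proof -
      have kk: "\<kappa> * \<kappa> \<le> \<kappa> * 1" using kap by (intro mult_left_mono) auto
      have "(1 + 2 * p) * (1 + eta) \<le> (1 + \<kappa> / 8) * (1 + \<kappa> / 32)"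
        using p_eq eta_le eta0 kap p_ge by (intro mult_mono) auto
      also have "\<dots> \<le> 1 + \<kappa> / 4"
      proof -
        have "(1 + \<kappa> / 8) * (1 + \<kappa> / 32) = 1 + 5 / 32 * \<kappa> + \<kappa> * \<kappa> / 256" by (simp add: field_simps)
        then show ?thesis using kk kap by linarith
      qed
      finally have "(1 + 2 * p) * (1 + eta) * n \<le> (1 + \<kappa> / 4) * n"
        by (intro mult_right_mono) auto
      also have "\<dots> \<le> (1 + \<kappa> / 4) * ((1 + \<kappa> / 4) * (real n - 1))"
      proof (intro mult_left_mono)
        have "16 + 2 * \<kappa> \<le> n * \<kappa>" using n_large kap by (simp add: field_simps)
        then show "n \<le> (1 + \<kappa> / 4) * (real n - 1)" using kap by (simp add: algebra_simps)
      qed (use kap in simp)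
      also have "\<dots> = ((1 + \<kappa> / 4) * (1 + \<kappa> / 4)) * (real n - 1)" by simp
      also have "\<dots> \<le> (1 + \<kappa>) * (real n - 1)"
      proof (intro mult_right_mono)
        show "(1 + \<kappa> / 4) * (1 + \<kappa> / 4) \<le> 1 + \<kappa>"
        proof -
          have "(1 + \<kappa> / 4) * (1 + \<kappa> / 4) = 1 + \<kappa> / 2 + \<kappa> * \<kappa> / 16" by (simp add: field_simps)
          then show ?thesis using kk kap by linarith
        qed
      qed (use n2 in simp)
      finally show ?thesis .
    qed
    show "800 * exp (\<kappa> * L) \<le> exp (G * L)"
    proof -
      have "800 * exp (\<kappa> * L) \<le> exp (30 * \<kappa> * L) * exp (\<kappa> * L)"
        using L_large(1) by (intro mult_right_mono) auto
      also have "\<dots> = 1 * exp (31 * \<kappa> * L)" by (simp flip: exp_add)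
      also have "\<dots> \<le> exp (G * L)"
        unfolding expG using exp_ge1 by (intro mult_right_mono) auto
      finally show ?thesis .
    qed
    show "1600 * (d * L\<^sup>2 / c) \<le> exp (G * L)"
    proof -
      \<comment> \<open>The origin of the exponent 1 / (i + 1): from d^(i+1) = c n and c \<ge> 1
        follows d / c \<le> n^(1/(i+1)), and s L is at most d L^2 / c.\<close>
      have "d ^ (i + 1) = c * n" using n2 by (simp add: c_def)
      then have "ln (d ^ (i + 1)) = ln c + L"
        using c1 n2 by (simp add: ln_mult L_def)
      then have "real (i + 1) * ln d = ln c + L" using d_pos by (subst (asm) ln_realpow)
      then have "ln d = (ln c + L) / real (i + 1)" by (subst eq_divide_eq) (simp add: mult.commute)
      also have "\<dots> = ln c / real (i + 1) + L / real (i + 1)" by (rule add_divide_distrib)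
      also have "\<dots> \<le> ln c + L / real (i + 1)"
      proof -
        have "ln c * 1 \<le> ln c * real (i + 1)" using c1 by (intro mult_left_mono) auto
        then have "ln c / real (i + 1) \<le> ln c" by (subst pos_divide_le_eq) simp_all
        then show ?thesis by simp
      qed
      finally have "exp (ln d) \<le> exp (ln c + L / real (i + 1))" by simp
      then have "d \<le> c * exp (L / real (i + 1))" using d_pos c1 by (simp add: exp_add)
      then have "d / c \<le> exp (L / real (i + 1))" using c1 by (simp add: field_simps)
      then have "d / c * (1600 * L\<^sup>2) \<le> exp (L / real (i + 1)) * exp (31 * \<kappa> * L)"
        using L_large(2) by (intro mult_mono) auto
      then show ?thesis by (simp add: expG mult_ac)
    qed
    show "1600 * L \<le> exp (G * L)"
    proof -
      have "1600 * L \<le> 1600 * L\<^sup>2" using L1 power_increasing[of 1 2 L] by simp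
      also have "\<dots> \<le> 1 * exp (31 * \<kappa> * L)" using L_large(2) by simp
      also have "\<dots> \<le> exp (G * L)"
        unfolding expG using exp_ge1 by (intro mult_right_mono) auto
      finally show ?thesis .
    qed
    show "8 \<le> \<kappa> * c" using c_large(2) kap by (simp add: field_simps)
  qed (use \<tau>_props G_def m_def d_ge c_large(1) \<epsilon> in auto)
  \<comment> \<open>There must be room to enlarge a resolving set to \<open>s\<close>
    vertices.\<close>
  have s_n: "s \<le> n"
  proof -
    have "d * L / c = L * n / d ^ i" using d_pow_i d_pos n2 c1 by (simp add: field_simps)
    also have "\<dots> \<le> L * n / d ^ 1"
      using i_ge d_ge L1 by (intro divide_left_mono power_increasing) auto
    also have "\<dots> \<le> n" using d_ge d_pos L1 mult_right_mono[of L d "real n"] by (simp add: field_simps)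
    finally have "real s \<le> n" using s_le by linarith
    then show ?thesis by simp
  qed
  have "1 - 6 / n \<le> bexp p (vertex_pairs {1..n}) (\<lambda>E. 1)
      - bexp p (vertex_pairs {1..n}) (\<lambda>E. of_bool (\<exists>R\<subseteq>{1..n}. card R = s \<and> resolving {1..n} E R))"
    using prob_resolving finite_pairs by simp
  also have "\<dots> \<le> bexp p (vertex_pairs {1..n}) (\<lambda>E. of_bool (X \<le> metric_dimension {1..n} E))"
  proof -
    have "bexp p (vertex_pairs {1..n}) (\<lambda>E. 1)
      \<le> bexp p (vertex_pairs {1..n}) (\<lambda>E. of_bool (X \<le> metric_dimension {1..n} E)
          + of_bool (\<exists>R\<subseteq>{1..n}. card R = s \<and> resolving {1..n} E R))"
    proof (intro bexp_mono p01)
      fix E :: "nat set set"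
      have "\<exists>R\<subseteq>{1..n}. card R = s \<and> resolving {1..n} E R" if "\<not> X \<le> metric_dimension {1..n} E"
      proof (rule ex_resolving_of_card)
        show "metric_dimension {1..n} E \<le> s"
          unfolding s_def using that by (intro le_nat_floor) simp
      qed (use s_n in auto)
      then show "1 \<le> of_bool (X \<le> metric_dimension {1..n} E)
          + (of_bool (\<exists>R\<subseteq>{1..n}. card R = s \<and> resolving {1..n} E R) :: real)"
        by (cases "X \<le> metric_dimension {1..n} E") simp_all
    qed
    then show ?thesis by (simp only: bexp_add)
  qed
  also have "\<dots> = measure_pmf.prob (random_graph n p) {E. X \<le> metric_dimension {1..n} E}"
    using prob_random_graph[OF p01, of n "\<lambda>E. X \<le> metric_dimension {1..n} E"] by simp
  finally show ?thesis by (simp add: X_def)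
qed

text \<open>Turns a family of statements, each eventually true for fixed \<open>k\<close>, into one
  in which \<open>k\<close> slowly tends to infinity with \<open>n\<close>. This produces the o(1)
  term.\<close>

lemma eventually_diagonal:
  fixes P :: "nat \<Rightarrow> nat \<Rightarrow> bool"
  assumes "\<And>k. eventually (P k) sequentially"
  shows "\<exists>f :: nat \<Rightarrow> nat. filterlim f at_top sequentially \<and> eventually (\<lambda>n. P (f n) n) sequentially"
proof -
  have "\<forall>k. \<exists>N. \<forall>n\<ge>N. P k n"
    using assms by (simp add: eventually_sequentially)
  then obtain N where N: "\<And>k n. N k \<le> n \<Longrightarrow> P k n" by metis
  let ?S = "\<lambda>n. {k. k \<le> n \<and> N k \<le> n}"
  \<comment> \<open>The largest index not exceeding \<open>n\<close> whose statement is guaranteed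
    from \<open>n\<close> on; it exists as soon as N 0 \<le> n.\<close>
  define f where "f n = Max (?S n)" for n
  have fin: "finite (?S n)" for n by simp
  have "filterlim f at_top sequentially"
    unfolding filterlim_at_top
  proof
    fix k
    have "k \<le> f n" if "max k (N k) \<le> n" for n
      unfolding f_def using that by (intro Max_ge[OF fin]) simp
    then show "eventually (\<lambda>n. k \<le> f n) sequentially"
      unfolding eventually_sequentially by blast
  qed
  moreover have "P (f n) n" if "N 0 \<le> n" for n
  proof -
    have "?S n \<noteq> {}" using that by auto
    from Max_in[OF fin this] show ?thesis
      using N[of "f n" n] unfolding f_def[symmetric] by simp
  qed
  then have "eventually (\<lambda>n. P (f n) n) sequentially"
    unfolding eventually_sequentially by blast
  ultimately show ?thesis by blast
qed

text \<open>For each fixed error \<open>e k\<close> the explicit bound holds with probability at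
  least 1 - 6/n for all large \<open>n\<close>; diagonalisation then merges these errors into a
  single null sequence.\<close>

theorem theorem4p4:
  fixes p d c :: "nat \<Rightarrow> real" and i :: "nat \<Rightarrow> nat"
  assumes "\<And>n. 0 \<le> p n \<and> p n \<le> 1"
    and "\<And>n. d n = p n * (real n - 1)"
    and "(\<lambda>n. ln (real n) ^ 3) \<in> o(d)"
    and "d \<in> o(\<lambda>n. real n)"
    and "\<forall>\<^sub>F n in sequentially. i n \<ge> 1"
    and "largest_exponent d i"
    and "\<And>n. c n = d n ^ (i n + 1) / real n"
    and "\<forall>\<^sub>F n in sequentially. exp (c n) > ln (real n) / (3 * ln (ln (real n)))"
    and "\<forall>\<^sub>F n in sequentially. c n \<le> 3 * ln (real n)"
  shows "\<exists>\<epsilon> :: nat \<Rightarrow> real. \<epsilon> \<longlonglongrightarrow> 0 \<and>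
    (\<lambda>n. measure_pmf.prob (random_graph n (p n))
       {E. real (metric_dimension {1..n} E) \<ge>
             (real (i n) / real (i n + 1) + \<epsilon> n)
               * inverse (d n ^ i n / real n + exp (- c n)) * ln (real n)}) \<longlonglongrightarrow> 1"
proof -
  have d0: "eventually (\<lambda>n. 0 \<le> d n) sequentially"
    using eventually_ge_at_top[of 1] by eventually_elim (use assms(1,2) in auto)
  let ?Pr = "\<lambda>\<epsilon> n. measure_pmf.prob (random_graph n (p n))
       {E. real (metric_dimension {1..n} E) \<ge>
             (real (i n) / real (i n + 1) + \<epsilon>)
               * inverse (d n ^ i n / real n + exp (- c n)) * ln (real n)}"
  define e where "e k = 1 / (2 * real (Suc k))" for k
  have "eventually (\<lambda>n. 1 - 6 / real n \<le> ?Pr (- e k) n) sequentially" for k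
  proof -
    define \<kappa> where "\<kappa> = e k / 40"
    have e: "0 < e k" "e k \<le> 1 / 2" by (simp_all add: e_def)
    have \<kappa>: "0 < \<kappa>" using e by (simp add: \<kappa>_def)
    \<comment> \<open>The second entry is the value from which on exp(-c/4) \<le> \<kappa>^2 / 4
      holds.\<close>
    define C where "C = max (8 / \<kappa>) (- 4 * ln (\<kappa>\<^sup>2 / 4))"
    have c: "eventually (\<lambda>n. C \<le> c n) sequentially"
    proof -
      \<comment> \<open>The assumed lower bound on exp(c n) tends to infinity, so \<open>c\<close>
        does as well.\<close>
      have "filterlim (\<lambda>n. ln (real n) / (3 * ln (ln (real n)))) at_top sequentially"
        by real_asymp
      then have "eventually (\<lambda>n. exp C \<le> ln (real n) / (3 * ln (ln (real n)))) sequentially"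
        unfolding filterlim_at_top by blast
      with assms(8) show ?thesis
      proof eventually_elim
        case (elim n)
        then have "exp C < exp (c n)" by linarith
        then show ?case by simp
      qed
    qed
    have "0 < 1 / (512 / \<kappa>)\<^sup>2" using \<kappa> by simp
    from landau_o.smallD[OF assms(3) this]
    have dL: "eventually (\<lambda>n. (512 / \<kappa>)\<^sup>2 * ln (real n) ^ 3 \<le> d n) sequentially"
      using d0 eventually_ge_at_top[of 1]
    proof eventually_elim
      case (elim n)
      then show ?case using \<kappa> by (simp add: field_simps)
    qed
    have "0 < \<kappa> / 32" using \<kappa> by simp
    from landau_o.smallD[OF assms(4) this]
    have dn: "eventually (\<lambda>n. d n \<le> \<kappa> / 32 * real n) sequentially"
      by eventually_elim auto
    have "(\<lambda>n. d n ^ i n) \<in> o(\<lambda>n. real n)"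
      using assms(6) by (simp add: largest_exponent_def)
    from landau_o.smallD[OF this, of 1]
    have d_pow: "eventually (\<lambda>n. d n ^ i n \<le> real n) sequentially"
      by simp (erule eventually_mono, auto)
    have "eventually (\<lambda>n. (1 / \<kappa>) ^ 3 \<le> (512 / \<kappa>)\<^sup>2 * ln (real n) ^ 3) sequentially"
      using \<kappa> by real_asymp
    moreover have "eventually (\<lambda>n. 16 / \<kappa> + 2 \<le> real n) sequentially"
      by real_asymp
    moreover have "eventually (\<lambda>n. 1 \<le> ln (real n)) sequentially"
      by real_asymp
    moreover have "eventually (\<lambda>n. 800 \<le> exp (30 * \<kappa> * ln (real n))) sequentially"
      using \<kappa> by real_asymp
    moreover have "eventually (\<lambda>n. 1600 * ln (real n) ^ 2 \<le> exp (31 * \<kappa> * ln (real n))) sequentially"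
      using \<kappa> by real_asymp
    ultimately show ?thesis
      using c dL dn d_pow assms(5,9)
    proof eventually_elim
      case (elim n)
      have C: "8 / \<kappa> \<le> c n" "- 4 * ln (\<kappa>\<^sup>2 / 4) \<le> c n"
        using elim(6) by (simp_all add: C_def)
      have "- (c n / 4) \<le> ln (\<kappa>\<^sup>2 / 4)" using C(2) by linarith
      then have "exp (- (c n / 4)) \<le> exp (ln (\<kappa>\<^sup>2 / 4))" by simp
      then have C': "exp (- (c n / 4)) \<le> \<kappa>\<^sup>2 / 4" using \<kappa> by simp
      have "1 - 6 / real n \<le> measure_pmf.prob (random_graph n (p n))
         {E. real (metric_dimension {1..n} E) \<ge>
            (real (i n) / real (i n + 1) - e k) * inverse (d n ^ i n / n + exp (- c n)) * ln (real n)}"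
        using elim assms(1)[of n] C C' e
        by (intro metric_dimension_lower_bound[where \<kappa> = \<kappa>] assms(2,7) refl) (auto simp: \<kappa>_def)
      then show ?case by simp
    qed
  qed
  then obtain f where f: "filterlim f at_top sequentially"
      "eventually (\<lambda>n. 1 - 6 / real n \<le> ?Pr (- e (f n)) n) sequentially"
    using eventually_diagonal[of "\<lambda>k n. 1 - 6 / real n \<le> ?Pr (- e k) n"] by blast
  have "(\<lambda>k. - e k) \<longlonglongrightarrow> 0"
    unfolding e_def by real_asymp
  then have "(\<lambda>n. - e (f n)) \<longlonglongrightarrow> 0"
    using f(1) by (rule filterlim_compose)
  moreover have "(\<lambda>n. ?Pr (- e (f n)) n) \<longlonglongrightarrow> 1"
  proof (rule tendsto_sandwich[OF f(2)])
    show "(\<lambda>n. 1 - 6 / real n) \<longlonglongrightarrow> 1"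
      by real_asymp
  qed auto
  ultimately show ?thesis
    by (intro exI[of _ "\<lambda>n. - e (f n)"]) simp
qed

end
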